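(* Let $\psi\in C^3$, and consider states $U=(\rho_1,\dots,\rho_n,v,\theta)$ with $\rho_i>0$, $v\in\mathbb R^3$, $\theta>0$. Assume $c_v:=e_\theta(\rho_1,\dots,\rho_n,\theta)>0$, that the matrix $\big((\rho\psi)_{\rho_i\rho_j}\big)_{i,j=1}^n$ is positive definite, that $\kappa\ge0$, and that the coefficients $b_{ij}$ are symmetric and strictly positive. Then the system $$\partial_t\rho_i+\mathrm{div}(\rho_iv)=-\mathrm{div}(\rho_iu_i)\ (i=1,\dots,n),\qquad \partial_t(\rho v)+\mathrm{div}(\rho v\otimes v+p\,\mathbb I)=0,$$ $$\partial_t\big(\rho e+\tfrac12\rho|v|^2\big)+\mathrm{div}\big((\rho e+\tfrac12\rho|v|^2)v+pv\big)=\mathrm{div}\Big(\kappa\nabla\theta-\sum_i(\rho_ie_i+p_i)u_i\Big),$$ with $u_1,\dots,u_n$ determined by $$-\sum_{j\neq i}b_{ij}\theta\rho_i\rho_j(u_i-u_j)=\epsilon d_i,\quad \sum_i\rho_iu_i=0,\quad d_i:=-\frac{\rho_i}{\rho}\nabla p+\rho_i\theta\nabla\frac{\mu_i}{\theta}-\theta(\rho_ie_i+p_i)\nabla\frac1\theta ,$$ is of hyperbolic-parabolic type, in the following sense. Let $A(U)=(\rho_1,\dots,\rho_n,\rho v_1,\rho v_2,\rho v_3,\rho e+\tfrac12\rho|v|^2)^\top$ and, for $\alpha=1,2,3$, let $F_\alpha(U)=\big(\rho_1v_\alpha,\dots,\rho_nv_\alpha,\rho v_1v_\alpha+p\delta_{1\alpha},\rho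 v_2v_\alpha+p\delta_{2\alpha},\rho v_3v_\alpha+p\delta_{3\alpha},(\rho e+\tfrac12\rho|v|^2+p)v_\alpha\big)^\top$. Then: (i) $A$ is $C^2$ and a bijection from its domain onto its range, and $\nabla A(U)$ is non-singular for every $U$ in the domain. (ii) With $H(U)=-\rho\eta$, $Q_\alpha(U)=-\rho\eta v_\alpha$ and $G(U)=\frac1\theta\big(\mu_1-\tfrac12|v|^2,\dots,\mu_n-\tfrac12|v|^2,v_1,v_2,v_3,-1\big)^\top$, one has $\nabla H=G\cdot\nabla A$ and $\nabla Q_\alpha=G\cdot\nabla F_\alpha$ for $\alpha=1,2,3$. (iii) The matrix $\nabla^2H-G\cdot\nabla^2A$, where $G\cdot\nabla^2A=\sum_{j=1}^{n+4}G_j\nabla^2A_j$, is symmetric and positive definite. (iv) Smooth solutions satisfy the entropy identity $$\partial_t(-\rho\eta)+\mathrm{div}(-\rho\eta v)=\mathrm{div}\Big(\frac1\theta\sum_i(\rho_ie_i+p_i-\rho_i\mu_i)u_i-\frac1\theta\kappa\nabla\theta\Big)-\zeta,\qquad \zeta:=\frac1{\theta^2}\kappa|\nabla\theta|^2-\frac1\theta\sum_iu_i\cdot d_i,$$ and the entropy production is non-negative: $\zeta\ge0$.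
   Context: The fluid has $n$ components with mass densities $\rho_i$, common velocity $v=(v_1,v_2,v_3)$, common temperature $\theta$, and total mass $\rho=\sum_i\rho_i$. $\delta_{k\alpha}$ is the Kronecker delta. All gradients and Hessians of functions of $U$ are with respect to $U=(\rho_1,\dots,\rho_n,v_1,v_2,v_3,\theta)$; subscripts $\rho_i,\theta$ denote partial derivatives in the variables $(\rho_1,\dots,\rho_n,\theta)$. Thermodynamics: the Helmholtz free energy $\rho\psi=\rho\psi(\rho_1,\dots,\rho_n,\theta)$ is given, and the entropy $\rho\eta$, internal energy $\rho e$, chemical potentials $\mu_i$ and total pressure $p$ are determined by $$(\rho\psi)_\theta=-\rho\eta,\quad \rho\psi=\rho e-\rho\eta\theta,\quad (\rho\psi)_{\rho_i}=\mu_i,\quad \rho\psi+p=\sum_i\rho_i\mu_i .$$ The partial internal energies $e_i$ and partial pressures $p_i$ are given constitutive functions of $(\rho_1,\dots,\rho_n,\theta)$ with $\sum_i\rho_ie_i=\rho e$ and $\sum_ip_i=p$. The heat conductivity $\kappa=\kappa(\rho_1,\dots,\rho_n,\theta)$ and the coefficients $b_{ij}=b_{ij}(\rho_i,\rho_j,\theta)$ are given functions, and $\epsilon>0$. *)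

theory Defs
  imports "HOL-Analysis.Analysis"
begin

section \<open>Calculus\<close>

text \<open>\<open>f\<close> is of class \<open>C\<^sup>k\<close> on \<open>S\<close>; meant for open \<open>S\<close> in a finite-dimensional space, where it
  suffices to control the directional derivatives of the total derivatives.\<close>

primrec Ck_on :: "nat \<Rightarrow> 'a::real_normed_vector set \<Rightarrow> ('a \<Rightarrow> 'b::real_normed_vector) \<Rightarrow> bool" where
  "Ck_on 0 S f \<longleftrightarrow> continuous_on S f"
| "Ck_on (Suc k) S f \<longleftrightarrow>
     (\<forall>x\<in>S. f differentiable (at x)) \<and> (\<forall>h. Ck_on k S (\<lambda>x. frechet_derivative f (at x) h))"

definition gradient :: "(real^'m \<Rightarrow> real) \<Rightarrow> real^'m \<Rightarrow> real^'m" where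
  "gradient f x = (\<chi> k. frechet_derivative f (at x) (axis k 1))"

definition hessian :: "(real^'m \<Rightarrow> real) \<Rightarrow> real^'m \<Rightarrow> real^'m^'m" where
  "hessian f x = jacobian (gradient f) (at x)"

definition symmetric_matrix :: "real^'m^'m \<Rightarrow> bool" where
  "symmetric_matrix M \<longleftrightarrow> transpose M = M"

definition positive_definite :: "real^'m^'m \<Rightarrow> bool" where
  "positive_definite M \<longleftrightarrow> (\<forall>x. x \<noteq> 0 \<longrightarrow> 0 < x \<bullet> (M *v x))"

text \<open>Space-time points are pairs \<open>(t, x)\<close> with \<open>x\<close> in three-dimensional space.\<close>

definition d_time :: "(real \<times> (real^3) \<Rightarrow> 'b::real_normed_vector) \<Rightarrow> real \<times> (real^3) \<Rightarrow> 'b" where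
  "d_time f z = frechet_derivative f (at z) (1, 0)"

definition d_space :: "3 \<Rightarrow> (real \<times> (real^3) \<Rightarrow> 'b::real_normed_vector) \<Rightarrow> real \<times> (real^3) \<Rightarrow> 'b" where
  "d_space k f z = frechet_derivative f (at z) (0, axis k 1)"

definition space_grad :: "(real \<times> (real^3) \<Rightarrow> real) \<Rightarrow> real \<times> (real^3) \<Rightarrow> real^3" where
  "space_grad f z = (\<chi> k. d_space k f z)"

definition divergence :: "(real \<times> (real^3) \<Rightarrow> real^3) \<Rightarrow> real \<times> (real^3) \<Rightarrow> real" where
  "divergence f z = (\<Sum>k\<in>UNIV. d_space k (\<lambda>y. f y $ k) z)"

definition tensor_divergence :: "(real \<times> (real^3) \<Rightarrow> real^3^3) \<Rightarrow> real \<times> (real^3) \<Rightarrow> real^3" where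
  "tensor_divergence T z = (\<chi> j. divergence (\<lambda>y. T y $ j) z)"

definition outer :: "real^3 \<Rightarrow> real^3 \<Rightarrow> real^3^3" where
  "outer v w = (\<chi> j k. v $ j * w $ k)"


section \<open>Thermodynamics\<close>

text \<open>Constitutive functions take a pair \<open>(r, \<theta>)\<close>: the vector \<open>r\<close> of the partial mass densities
  (the finite type \<open>'n\<close> indexes the components) and the temperature \<open>\<theta>\<close>.\<close>

definition thermo_domain :: "((real^'n) \<times> real) set" where
  "thermo_domain = {(r, \<theta>). (\<forall>i. 0 < r $ i) \<and> 0 < \<theta>}"

definition total_mass :: "real^'n \<Rightarrow> real" where
  "total_mass r = (\<Sum>i\<in>UNIV. r $ i)"

definition pd_rho :: "'n \<Rightarrow> ((real^'n) \<times> real \<Rightarrow> real) \<Rightarrow> (real^'n) \<times> real \<Rightarrow> real" where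
  "pd_rho i f w = frechet_derivative f (at w) (axis i 1, 0)"

definition pd_theta :: "((real^'n) \<times> real \<Rightarrow> real) \<Rightarrow> (real^'n) \<times> real \<Rightarrow> real" where
  "pd_theta f w = frechet_derivative f (at w) (0, 1)"

definition free_energy :: "((real^'n) \<times> real \<Rightarrow> real) \<Rightarrow> (real^'n) \<times> real \<Rightarrow> real" where
  "free_energy \<psi> w = total_mass (fst w) * \<psi> w"

definition thermodynamic_relations ::
  "((real^'n) \<times> real \<Rightarrow> real) \<Rightarrow> ((real^'n) \<times> real \<Rightarrow> real) \<Rightarrow> ((real^'n) \<times> real \<Rightarrow> real) \<Rightarrow>
   ('n \<Rightarrow> (real^'n) \<times> real \<Rightarrow> real) \<Rightarrow> ((real^'n) \<times> real \<Rightarrow> real) \<Rightarrow> bool" where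
  "thermodynamic_relations \<psi> \<eta> e \<mu> p \<longleftrightarrow> (\<forall>(r, \<theta>)\<in>thermo_domain.
     pd_theta (free_energy \<psi>) (r, \<theta>) = - (total_mass r * \<eta> (r, \<theta>)) \<and>
     free_energy \<psi> (r, \<theta>) = total_mass r * e (r, \<theta>) - total_mass r * \<eta> (r, \<theta>) * \<theta> \<and>
     (\<forall>i. pd_rho i (free_energy \<psi>) (r, \<theta>) = \<mu> i (r, \<theta>)) \<and>
     free_energy \<psi> (r, \<theta>) + p (r, \<theta>) = (\<Sum>i\<in>UNIV. r $ i * \<mu> i (r, \<theta>)))"

definition partial_relations ::
  "((real^'n) \<times> real \<Rightarrow> real) \<Rightarrow> ((real^'n) \<times> real \<Rightarrow> real) \<Rightarrow>
   ('n \<Rightarrow> (real^'n) \<times> real \<Rightarrow> real) \<Rightarrow> ('n \<Rightarrow> (real^'n) \<times> real \<Rightarrow> real) \<Rightarrow> bool" where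
  "partial_relations e p e_part p_part \<longleftrightarrow> (\<forall>(r, \<theta>)\<in>thermo_domain.
     (\<Sum>i\<in>UNIV. r $ i * e_part i (r, \<theta>)) = total_mass r * e (r, \<theta>) \<and>
     (\<Sum>i\<in>UNIV. p_part i (r, \<theta>)) = p (r, \<theta>))"


section \<open>States\<close>

text \<open>The state \<open>U = (\<rho>\<^sub>1, \<dots>, \<rho>\<^sub>n, v\<^sub>1, v\<^sub>2, v\<^sub>3, \<theta>)\<close> is a vector indexed by the sum type
  \<open>'n + 3 + 1\<close>, which has \<open>n + 4\<close> elements.\<close>

definition stack :: "real^'n \<Rightarrow> real^3 \<Rightarrow> real \<Rightarrow> real^('n::finite + 3 + 1)" where
  "stack r v s = (\<chi> k. case k of Inl i \<Rightarrow> r $ i | Inr (Inl j) \<Rightarrow> v $ j | Inr (Inr _) \<Rightarrow> s)"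

definition dens :: "real^('n::finite + 3 + 1) \<Rightarrow> real^'n" where
  "dens U = (\<chi> i. U $ Inl i)"

definition velo :: "real^('n::finite + 3 + 1) \<Rightarrow> real^3" where
  "velo U = (\<chi> j. U $ Inr (Inl j))"

definition temp :: "real^('n::finite + 3 + 1) \<Rightarrow> real" where
  "temp U = U $ Inr (Inr 1)"

definition mass :: "real^('n::finite + 3 + 1) \<Rightarrow> real" where
  "mass U = total_mass (dens U)"

definition thermo :: "real^('n::finite + 3 + 1) \<Rightarrow> (real^'n) \<times> real" where
  "thermo U = (dens U, temp U)"

definition state_domain :: "(real^('n::finite + 3 + 1)) set" where
  "state_domain = {U. (\<forall>i. 0 < dens U $ i) \<and> 0 < temp U}"

definition total_energy :: "((real^'n) \<times> real \<Rightarrow> real) \<Rightarrow> real^('n::finite + 3 + 1) \<Rightarrow> real" where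
  "total_energy e U = mass U * e (thermo U) + 1/2 * mass U * (norm (velo U))\<^sup>2"

definition A_map ::
  "((real^'n) \<times> real \<Rightarrow> real) \<Rightarrow> real^('n::finite + 3 + 1) \<Rightarrow> real^('n + 3 + 1)" where
  "A_map e U = stack (dens U) (mass U *\<^sub>R velo U) (total_energy e U)"

definition F_map ::
  "((real^'n) \<times> real \<Rightarrow> real) \<Rightarrow> ((real^'n) \<times> real \<Rightarrow> real) \<Rightarrow> 3 \<Rightarrow>
   real^('n::finite + 3 + 1) \<Rightarrow> real^('n + 3 + 1)" where
  "F_map e p \<alpha> U = stack
     (\<chi> i. dens U $ i * velo U $ \<alpha>)
     (\<chi> k. mass U * velo U $ k * velo U $ \<alpha> + p (thermo U) * (if k = \<alpha> then 1 else 0))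
     ((total_energy e U + p (thermo U)) * velo U $ \<alpha>)"

definition H_fun :: "((real^'n) \<times> real \<Rightarrow> real) \<Rightarrow> real^('n::finite + 3 + 1) \<Rightarrow> real" where
  "H_fun \<eta> U = - (mass U * \<eta> (thermo U))"

definition Q_fun :: "((real^'n) \<times> real \<Rightarrow> real) \<Rightarrow> 3 \<Rightarrow> real^('n::finite + 3 + 1) \<Rightarrow> real" where
  "Q_fun \<eta> \<alpha> U = - (mass U * \<eta> (thermo U) * velo U $ \<alpha>)"

definition G_map ::
  "('n \<Rightarrow> (real^'n) \<times> real \<Rightarrow> real) \<Rightarrow> real^('n::finite + 3 + 1) \<Rightarrow> real^('n + 3 + 1)" where
  "G_map \<mu> U = (1 / temp U) *\<^sub>R
     stack (\<chi> i. \<mu> i (thermo U) - 1/2 * (norm (velo U))\<^sup>2) (velo U) (- 1)"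


section \<open>The system\<close>

text \<open>\<open>U\<close> is a state-valued field on space-time; \<open>u i\<close> is the diffusion velocity field of
  component \<open>i\<close>.\<close>

definition diffusive_force ::
  "('n \<Rightarrow> (real^'n) \<times> real \<Rightarrow> real) \<Rightarrow> ((real^'n) \<times> real \<Rightarrow> real) \<Rightarrow>
   ('n \<Rightarrow> (real^'n) \<times> real \<Rightarrow> real) \<Rightarrow> ('n \<Rightarrow> (real^'n) \<times> real \<Rightarrow> real) \<Rightarrow>
   (real \<times> (real^3) \<Rightarrow> real^('n::finite + 3 + 1)) \<Rightarrow> 'n \<Rightarrow> real \<times> (real^3) \<Rightarrow> real^3" where
  "diffusive_force \<mu> p e_part p_part U i z =
     (let r = dens (U z); \<theta> = temp (U z); w = thermo (U z) in
        - (r $ i / mass (U z)) *\<^sub>R space_grad (\<lambda>y. p (thermo (U y))) z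
        + (r $ i * \<theta>) *\<^sub>R space_grad (\<lambda>y. \<mu> i (thermo (U y)) / temp (U y)) z
        - (\<theta> * (r $ i * e_part i w + p_part i w)) *\<^sub>R space_grad (\<lambda>y. 1 / temp (U y)) z)"

definition heat_flux ::
  "('n \<Rightarrow> (real^'n) \<times> real \<Rightarrow> real) \<Rightarrow> ('n \<Rightarrow> (real^'n) \<times> real \<Rightarrow> real) \<Rightarrow>
   ((real^'n) \<times> real \<Rightarrow> real) \<Rightarrow>
   (real \<times> (real^3) \<Rightarrow> real^('n::finite + 3 + 1)) \<Rightarrow> ('n \<Rightarrow> real \<times> (real^3) \<Rightarrow> real^3) \<Rightarrow>
   real \<times> (real^3) \<Rightarrow> real^3" where
  "heat_flux e_part p_part \<kappa> U u z =
     \<kappa> (thermo (U z)) *\<^sub>R space_grad (\<lambda>y. temp (U y)) z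
     - (\<Sum>i\<in>UNIV. (dens (U z) $ i * e_part i (thermo (U z)) + p_part i (thermo (U z))) *\<^sub>R u i z)"

text \<open>Only what is differentiated in the system has to be of class \<open>C\<^sup>1\<close>. For \<open>heat_flux\<close> this
  is a condition of its own because no regularity of \<open>e_part\<close>, \<open>p_part\<close>, \<open>\<kappa>\<close> is prescribed.\<close>

definition smooth_solution ::
  "((real^'n) \<times> real \<Rightarrow> real) \<Rightarrow> ('n \<Rightarrow> (real^'n) \<times> real \<Rightarrow> real) \<Rightarrow> ((real^'n) \<times> real \<Rightarrow> real) \<Rightarrow>
   ('n \<Rightarrow> (real^'n) \<times> real \<Rightarrow> real) \<Rightarrow> ('n \<Rightarrow> (real^'n) \<times> real \<Rightarrow> real) \<Rightarrow>
   ((real^'n) \<times> real \<Rightarrow> real) \<Rightarrow> ('n \<Rightarrow> 'n \<Rightarrow> real \<Rightarrow> real \<Rightarrow> real \<Rightarrow> real) \<Rightarrow> real \<Rightarrow>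
   (real \<times> (real^3)) set \<Rightarrow> (real \<times> (real^3) \<Rightarrow> real^('n::finite + 3 + 1)) \<Rightarrow>
   ('n \<Rightarrow> real \<times> (real^3) \<Rightarrow> real^3) \<Rightarrow> bool" where
  "smooth_solution e \<mu> p e_part p_part \<kappa> b \<epsilon> W U u \<longleftrightarrow>
     Ck_on 1 W U \<and> (\<forall>i. Ck_on 1 W (u i)) \<and> Ck_on 1 W (heat_flux e_part p_part \<kappa> U u) \<and>
     (\<forall>z\<in>W.
        U z \<in> state_domain \<and>
        (\<forall>i. d_time (\<lambda>y. dens (U y) $ i) z + divergence (\<lambda>y. dens (U y) $ i *\<^sub>R velo (U y)) z
             = - divergence (\<lambda>y. dens (U y) $ i *\<^sub>R u i y) z) \<and>
        d_time (\<lambda>y. mass (U y) *\<^sub>R velo (U y)) z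
          + tensor_divergence (\<lambda>y. mass (U y) *\<^sub>R outer (velo (U y)) (velo (U y))
                                  + p (thermo (U y)) *\<^sub>R mat 1) z = 0 \<and>
        d_time (\<lambda>y. total_energy e (U y)) z
          + divergence (\<lambda>y. total_energy e (U y) *\<^sub>R velo (U y) + p (thermo (U y)) *\<^sub>R velo (U y)) z
          = divergence (heat_flux e_part p_part \<kappa> U u) z \<and>
        (\<forall>i. - (\<Sum>j\<in>UNIV - {i}.
                  (b i j (dens (U z) $ i) (dens (U z) $ j) (temp (U z)) * temp (U z)
                     * dens (U z) $ i * dens (U z) $ j) *\<^sub>R (u i z - u j z))
             = \<epsilon> *\<^sub>R diffusive_force \<mu> p e_part p_part U i z) \<and>
        (\<Sum>i\<in>UNIV. dens (U z) $ i *\<^sub>R u i z) = 0)"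

definition entropy_production ::
  "('n \<Rightarrow> (real^'n) \<times> real \<Rightarrow> real) \<Rightarrow> ((real^'n) \<times> real \<Rightarrow> real) \<Rightarrow>
   ('n \<Rightarrow> (real^'n) \<times> real \<Rightarrow> real) \<Rightarrow> ('n \<Rightarrow> (real^'n) \<times> real \<Rightarrow> real) \<Rightarrow>
   ((real^'n) \<times> real \<Rightarrow> real) \<Rightarrow>
   (real \<times> (real^3) \<Rightarrow> real^('n::finite + 3 + 1)) \<Rightarrow> ('n \<Rightarrow> real \<times> (real^3) \<Rightarrow> real^3) \<Rightarrow>
   real \<times> (real^3) \<Rightarrow> real" where
  "entropy_production \<mu> p e_part p_part \<kappa> U u z =
     1 / (temp (U z))\<^sup>2 * \<kappa> (thermo (U z)) * (norm (space_grad (\<lambda>y. temp (U y)) z))\<^sup>2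
     - 1 / temp (U z) * (\<Sum>i\<in>UNIV. u i z \<bullet> diffusive_force \<mu> p e_part p_part U i z)"

end

theory Submission
  imports Defs
begin

text \<open>
  Everything rests on the Gibbs relation \<open>d(\<rho>e) = \<Sum>\<^sub>i \<mu>\<^sub>i d\<rho>\<^sub>i + \<theta> d(\<rho>\<eta>)\<close>, which the thermodynamic relations
  imply (\<open>energy_has_derivative\<close>). It says that pairing \<open>G\<close> with the differential of the conserved
  quantities yields the differential of \<open>H = - \<rho>\<eta>\<close> (\<open>entropy_compatible\<close>), and together with the
  Euler relation \<open>\<rho>e - \<theta> \<rho>\<eta> + p = \<Sum>\<^sub>i \<rho>\<^sub>i \<mu>\<^sub>i\<close> it yields the same for the fluxes (\<open>entropy_flux_compatible\<close>).

  The map \<open>A\<close> is invertible because densities and velocity can be read off directly and the internal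
  energy increases strictly with the temperature (\<open>energy_strict_mono\<close>).

  Differentiating \<open>\<nabla>H = G \<cdot> \<nabla>A\<close> shows that \<open>\<nabla>\<^sup>2H - G \<cdot> \<nabla>\<^sup>2A = (\<nabla>A)\<^sup>T \<nabla>G\<close>
  (\<open>compatible_entropy_hessian\<close>); it is symmetric by Schwarz's theorem
  (\<open>second_derivative_symmetric\<close>). In a direction \<open>(d\<rho>\<^sub>i, dv, d\<theta>)\<close> its quadratic form is \<open>1 / \<theta>\<close> times
  \<open>\<Sum>\<^sub>i d\<rho>\<^sub>i d\<mu>\<^sub>i + d\<theta> d(\<rho>\<eta>) + \<rho> |dv|\<^sup>2\<close>. Since \<open>- \<rho>\<eta>\<close> and the \<open>\<mu>\<^sub>i\<close> are first derivatives of one potential, the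
  terms mixing \<open>d\<rho>\<^sub>i\<close> with \<open>d\<theta>\<close> cancel, and what remains is the Hessian of \<open>\<rho>\<psi>\<close> in the densities, the heat
  capacity term and the kinetic term, all positive (\<open>thermodynamic_stability\<close>,
  \<open>entropy_quadratic_form_pos\<close>).

  The entropy identity is the system tested with \<open>G\<close>: compatibility turns the transport part into that
  of the entropy (\<open>entropy_transport\<close>), and the diffusive part is rearranged by the product rule, where
  \<open>\<Sum>\<^sub>i \<rho>\<^sub>i u\<^sub>i = 0\<close> removes the kinetic and pressure terms (\<open>entropy_balance\<close>). The production is heat
  conduction plus the power of a symmetric friction, a sum of squares (\<open>friction_dissipation\<close>).
\<close>

section \<open>Functions of class \<open>C\<^sup>k\<close>\<close>

text \<open>Changing a function outside the open set \<open>S\<close> does not affect its derivatives on \<open>S\<close>. This is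
  what transfers smoothness across the thermodynamic relations, which hold on the domain only.\<close>

lemma Ck_on_cong:
  assumes "open S" "\<And>x. x \<in> S \<Longrightarrow> f x = g x"
  shows "Ck_on k S f \<longleftrightarrow> Ck_on k S g"
proof -
  have "Ck_on k S g" if "Ck_on k S f" "\<And>x. x \<in> S \<Longrightarrow> f x = g x" for f g :: "'a \<Rightarrow> 'b"
    using that
  proof (induction k arbitrary: f g)
    case 0
    then show ?case by (simp cong: continuous_on_cong)
  next
    case (Suc k)
    have d: "(g has_derivative frechet_derivative f (at x)) (at x)" if "x \<in> S" for x
    proof -
      have "(f has_derivative frechet_derivative f (at x)) (at x)"
        using Suc.prems(1) that by (auto simp: frechet_derivative_works)
      then show ?thesis
        by (rule has_derivative_transform_within_open[OF _ assms(1) that]) (rule Suc.prems(2))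
    qed
    have eq: "frechet_derivative f (at x) = frechet_derivative g (at x)" if "x \<in> S" for x
      using frechet_derivative_at[OF d[OF that]] .
    have "Ck_on k S (\<lambda>x. frechet_derivative g (at x) h)" for h
      by (rule Suc.IH[where f="\<lambda>x. frechet_derivative f (at x) h"]) (use Suc.prems eq in auto)
    moreover have "\<forall>x\<in>S. g differentiable (at x)"
      using d by (auto intro: differentiableI)
    ultimately show ?case by simp
  qed
  from this[of f g] this[of g f] show ?thesis using assms(2) by auto
qed

lemma Ck_on_Suc_imp: "Ck_on (Suc k) S f \<Longrightarrow> Ck_on k S f"
proof (induction k arbitrary: f)
  case 0
  then show ?case
    by (auto intro!: differentiable_imp_continuous_on differentiable_at_imp_differentiable_on)
next
  case (Suc k)
  then show ?case by (metis Ck_on.simps(2))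
qed

lemma Ck_on_mono: "Ck_on k S f \<Longrightarrow> j \<le> k \<Longrightarrow> Ck_on j S f"
  by (induction k) (auto simp del: Ck_on.simps simp: le_Suc_eq dest: Ck_on_Suc_imp)

lemma Ck_on_Suc_derivative: "Ck_on (Suc k) S f \<Longrightarrow> Ck_on k S (\<lambda>x. frechet_derivative f (at x) h)"
  by simp

text \<open>The derivative \<open>f'\<close> may be any expression; with it the closure properties below become
  inductions on \<open>k\<close> that never unfold the definition of the derivative.\<close>

lemma Ck_on_SucI:
  assumes "open S" "\<And>x. x \<in> S \<Longrightarrow> (f has_derivative f' x) (at x)"
    and "\<And>h. Ck_on k S (\<lambda>x. f' x h)"
  shows "Ck_on (Suc k) S f"
proof -
  have "frechet_derivative f (at x) h = f' x h" if "x \<in> S" for x h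
    using frechet_derivative_at[OF assms(2)[OF that]] by simp
  then show ?thesis
    using assms(2,3) Ck_on_cong[OF assms(1), of "\<lambda>x. frechet_derivative f (at x) h" "\<lambda>x. f' x h" k for h]
    by (auto intro: differentiableI)
qed

lemma Ck_on_const: "open S \<Longrightarrow> Ck_on k S (\<lambda>x. c)"
  by (induction k arbitrary: c) auto

lemma Ck_on_linear:
  assumes "open S" "bounded_linear f" shows "Ck_on k S f"
proof (cases k)
  case 0
  then show ?thesis using assms by (simp add: linear_continuous_on)
next
  case (Suc j)
  show ?thesis unfolding Suc
    by (rule Ck_on_SucI[OF assms(1) bounded_linear_imp_has_derivative[OF assms(2)] Ck_on_const[OF assms(1)]])
qed

lemma Ck_on_add:
  assumes "open S" shows "Ck_on k S f \<Longrightarrow> Ck_on k S g \<Longrightarrow> Ck_on k S (\<lambda>x. f x + g x)"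
proof (induction k arbitrary: f g)
  case 0
  then show ?case by (simp add: continuous_on_add)
next
  case (Suc k)
  show ?case
  proof (rule Ck_on_SucI[OF assms])
    show "((\<lambda>x. f x + g x) has_derivative
        (\<lambda>h. frechet_derivative f (at x) h + frechet_derivative g (at x) h)) (at x)" if "x \<in> S" for x
      using Suc.prems that by (intro has_derivative_add) (auto simp: frechet_derivative_works)
    show "Ck_on k S (\<lambda>x. frechet_derivative f (at x) h + frechet_derivative g (at x) h)" for h
      by (rule Suc.IH) (use Suc.prems in auto)
  qed
qed

lemma Ck_on_compose_linear:
  assumes "open S" "bounded_linear L" shows "Ck_on k S f \<Longrightarrow> Ck_on k S (\<lambda>x. L (f x))"
proof (induction k arbitrary: f)
  case 0
  then show ?case using assms(2) by (simp add: bounded_linear.continuous_on)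
next
  case (Suc k)
  show ?case
  proof (rule Ck_on_SucI[OF assms(1)])
    show "((\<lambda>x. L (f x)) has_derivative (\<lambda>h. L (frechet_derivative f (at x) h))) (at x)"
      if "x \<in> S" for x
      using Suc.prems that by (intro bounded_linear.has_derivative[OF assms(2)]) (auto simp: frechet_derivative_works)
    show "Ck_on k S (\<lambda>x. L (frechet_derivative f (at x) h))" for h
      by (rule Suc.IH) (use Suc.prems in auto)
  qed
qed

lemma Ck_on_precompose_linear:
  assumes "open S" "bounded_linear L"
  shows "Ck_on k S f \<Longrightarrow> Ck_on k (L -` S) (\<lambda>x. f (L x))"
proof (induction k arbitrary: f)
  case 0
  then show ?case
    using continuous_on_compose2[of S f "L -` S" L] linear_continuous_on[OF assms(2)] by auto
next
  case (Suc k)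
  have op: "open (L -` S)"
    by (simp add: assms linear_continuous_on open_vimage)
  show ?case
  proof (rule Ck_on_SucI[OF op])
    show "((\<lambda>x. f (L x)) has_derivative (\<lambda>h. frechet_derivative f (at (L x)) (L h))) (at x)"
      if "x \<in> L -` S" for x
      using Suc.prems that
      by (intro has_derivative_compose[OF bounded_linear_imp_has_derivative[OF assms(2)]])
        (auto simp: frechet_derivative_works)
    show "Ck_on k (L -` S) (\<lambda>x. frechet_derivative f (at (L x)) (L h))" for h
      by (rule Suc.IH) (use Suc.prems in auto)
  qed
qed

lemma Ck_on_mult:
  fixes f g :: "'a::real_normed_vector \<Rightarrow> real"
  assumes "open S" shows "Ck_on k S f \<Longrightarrow> Ck_on k S g \<Longrightarrow> Ck_on k S (\<lambda>x. f x * g x)"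
proof (induction k arbitrary: f g)
  case 0
  then show ?case by (simp add: continuous_on_mult)
next
  case (Suc k)
  show ?case
  proof (rule Ck_on_SucI[OF assms])
    show "((\<lambda>x. f x * g x) has_derivative
        (\<lambda>h. f x * frechet_derivative g (at x) h + frechet_derivative f (at x) h * g x)) (at x)"
      if "x \<in> S" for x
      using Suc.prems that by (intro has_derivative_mult) (auto simp: frechet_derivative_works)
    show "Ck_on k S (\<lambda>x. f x * frechet_derivative g (at x) h + frechet_derivative f (at x) h * g x)"
      for h
      by (intro Ck_on_add[OF assms] Suc.IH)
        (use Suc.prems Ck_on_Suc_imp[OF Suc.prems(1)] Ck_on_Suc_imp[OF Suc.prems(2)] in auto)
  qed
qed

lemma Ck_on_uminus: "open S \<Longrightarrow> Ck_on k S f \<Longrightarrow> Ck_on k S (\<lambda>x. - f x)"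
  by (rule Ck_on_compose_linear[OF _ bounded_linear_minus[OF bounded_linear_ident]])

lemma Ck_on_diff:
  "open S \<Longrightarrow> Ck_on k S f \<Longrightarrow> Ck_on k S g \<Longrightarrow> Ck_on k S (\<lambda>x. f x - g x)"
  using Ck_on_add[of S k f "\<lambda>x. - g x"] Ck_on_uminus[of S k g] by simp

lemma Ck_on_sum:
  assumes "open S" "\<And>i. i \<in> I \<Longrightarrow> Ck_on k S (f i)"
  shows "Ck_on k S (\<lambda>x. \<Sum>i\<in>I. f i x)"
  using assms(2)
  by (induction I rule: infinite_finite_induct) (auto intro: Ck_on_add Ck_on_const assms(1))

lemma Ck_on_vec:
  fixes f :: "'a::real_normed_vector \<Rightarrow> real^'m"
  assumes "open S" "\<And>i. Ck_on k S (\<lambda>x. f x $ i)" shows "Ck_on k S f"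
proof -
  have "Ck_on k S (\<lambda>x. \<Sum>i\<in>UNIV. f x $ i *\<^sub>R axis i (1::real))"
    using assms
    by (intro Ck_on_sum Ck_on_compose_linear[where L="\<lambda>c. c *\<^sub>R axis i 1" for i] bounded_linear_scaleR_left) auto
  moreover have "(\<lambda>x. \<Sum>i\<in>UNIV. f x $ i *\<^sub>R axis i (1::real)) = f"
    by (auto simp: vec_eq_iff axis_def if_distrib sum.delta cong: if_cong)
  ultimately show ?thesis by simp
qed

lemma Ck_on_vec_nth:
  "open S \<Longrightarrow> Ck_on k S f \<Longrightarrow> Ck_on k S (\<lambda>x. f x $ i :: real)"
  by (rule Ck_on_compose_linear[OF _ bounded_linear_vec_nth])

text \<open>Two mean value theorems: first for \<open>s \<mapsto> f (x + s h + d k) - f (x + s h)\<close>, then in the direction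
  \<open>k\<close> for the derivative of \<open>f\<close> along \<open>h\<close>. The left-hand side is symmetric in \<open>h\<close> and \<open>k\<close>, the
  right-hand side records the order of differentiation.\<close>

lemma second_difference_mean_value:
  fixes f :: "'a::real_normed_vector \<Rightarrow> real"
  assumes "Ck_on 2 S f" "0 < d"
    and S: "\<And>s t. 0 \<le> s \<Longrightarrow> s \<le> d \<Longrightarrow> 0 \<le> t \<Longrightarrow> t \<le> d \<Longrightarrow> x + s *\<^sub>R h + t *\<^sub>R k \<in> S"
  obtains s t where "0 < s" "s < d" "0 < t" "t < d"
    "f (x + d *\<^sub>R h + d *\<^sub>R k) - f (x + d *\<^sub>R h) - f (x + d *\<^sub>R k) + f x
       = d\<^sup>2 * frechet_derivative (\<lambda>y. frechet_derivative f (at y) h) (at (x + s *\<^sub>R h + t *\<^sub>R k)) k"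
proof -
  have deriv: "(g has_derivative frechet_derivative g (at y)) (at y)"
    if "Ck_on (Suc j) S g" "y \<in> S" for g :: "'a \<Rightarrow> real" and j y
    using that by (auto simp: frechet_derivative_works)
  have line: "((\<lambda>s. g (y + s *\<^sub>R a)) has_real_derivative frechet_derivative g (at (y + s *\<^sub>R a)) a) (at s)"
    if "Ck_on (Suc j) S g" "y + s *\<^sub>R a \<in> S" for g :: "'a \<Rightarrow> real" and j y s a
  proof -
    have "((\<lambda>s. y + s *\<^sub>R a) has_derivative (\<lambda>c. c *\<^sub>R a)) (at s)"
      by (auto intro!: derivative_eq_intros)
    from has_derivative_compose[OF this deriv[OF that]]
    have "((\<lambda>s. g (y + s *\<^sub>R a)) has_derivative (\<lambda>c. frechet_derivative g (at (y + s *\<^sub>R a)) (c *\<^sub>R a))) (at s)" .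
    moreover have "frechet_derivative g (at (y + s *\<^sub>R a)) (c *\<^sub>R a)
        = frechet_derivative g (at (y + s *\<^sub>R a)) a * c" for c
      using linear_scale[OF has_derivative_linear[OF deriv[OF that]]] by simp
    ultimately show ?thesis by (simp add: has_field_derivative_def)
  qed
  have f2: "Ck_on (Suc 1) S f" using assms(1) by (simp add: numeral_2_eq_2)
  let ?g = "\<lambda>y. frechet_derivative f (at y) h"
  have g1: "Ck_on (Suc 0) S ?g" using f2 by simp
  have "\<exists>s>0. s < d \<and> (f ((x + d *\<^sub>R k) + d *\<^sub>R h) - f (x + d *\<^sub>R h)) - (f ((x + d *\<^sub>R k) + 0 *\<^sub>R h) - f (x + 0 *\<^sub>R h))
      = (d - 0) * (?g ((x + d *\<^sub>R k) + s *\<^sub>R h) - ?g (x + s *\<^sub>R h))"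
  proof (rule MVT2[OF assms(2)])
    fix s assume s: "0 \<le> s" "s \<le> d"
    have 1: "x + d *\<^sub>R k + s *\<^sub>R h \<in> S"
      using S[of s d] s assms(2) by (simp add: add_ac)
    have 2: "x + s *\<^sub>R h \<in> S" using S[of s 0] s assms(2) by simp
    show "((\<lambda>s. f ((x + d *\<^sub>R k) + s *\<^sub>R h) - f (x + s *\<^sub>R h)) has_real_derivative
        (?g ((x + d *\<^sub>R k) + s *\<^sub>R h) - ?g (x + s *\<^sub>R h))) (at s)"
      by (intro DERIV_diff line[OF f2 1] line[OF f2 2])
  qed
  then obtain s where s: "0 < s" "s < d"
    and eq1: "f (x + d *\<^sub>R h + d *\<^sub>R k) - f (x + d *\<^sub>R h) - f (x + d *\<^sub>R k) + f x
      = d * (?g (x + s *\<^sub>R h + d *\<^sub>R k) - ?g (x + s *\<^sub>R h))"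
    by (auto simp: algebra_simps)
  have "\<exists>t>0. t < d \<and> ?g ((x + s *\<^sub>R h) + d *\<^sub>R k) - ?g ((x + s *\<^sub>R h) + 0 *\<^sub>R k)
      = (d - 0) * frechet_derivative ?g (at ((x + s *\<^sub>R h) + t *\<^sub>R k)) k"
  proof (rule MVT2[OF assms(2)])
    fix t assume t: "0 \<le> t" "t \<le> d"
    have 1: "x + s *\<^sub>R h + t *\<^sub>R k \<in> S"
      using S[of s t] s t assms(2) by simp
    show "((\<lambda>t. ?g ((x + s *\<^sub>R h) + t *\<^sub>R k)) has_real_derivative
        frechet_derivative ?g (at ((x + s *\<^sub>R h) + t *\<^sub>R k)) k) (at t)"
      by (rule line[OF g1 1])
  qed
  then obtain t where t: "0 < t" "t < d" and eq2:
     "?g (x + s *\<^sub>R h + d *\<^sub>R k) - ?g (x + s *\<^sub>R h)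
      = d * frechet_derivative ?g (at (x + s *\<^sub>R h + t *\<^sub>R k)) k"
    by auto
  show thesis
    by (rule that[OF s t]) (simp add: eq1 eq2 power2_eq_square)
qed

text \<open>Schwarz's theorem. Exchanging \<open>h\<close> and \<open>k\<close> in the mean value formula shows that the two mixed
  derivatives agree up to moving the base point by an arbitrarily small amount; continuity at \<open>x\<close>
  removes the shift.\<close>

lemma second_derivative_symmetric:
  fixes f :: "'a::real_normed_vector \<Rightarrow> real"
  assumes "open S" "Ck_on 2 S f" "x \<in> S"
  shows "frechet_derivative (\<lambda>y. frechet_derivative f (at y) h) (at x) k
       = frechet_derivative (\<lambda>y. frechet_derivative f (at y) k) (at x) h"
proof -
  define D2 where "D2 a b = (\<lambda>y. frechet_derivative (\<lambda>y. frechet_derivative f (at y) a) (at y) b)" for a b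
  have cont: "isCont (D2 a b) x" for a b
    using assms(2) unfolding D2_def
    by (intro continuous_on_interior[of S]) (auto simp: numeral_2_eq_2 interior_open assms)
  have "\<bar>D2 h k x - D2 k h x\<bar> < \<epsilon>" if "\<epsilon> > 0" for \<epsilon>
  proof -
    have "\<exists>d>0. \<forall>y. dist y x < d \<longrightarrow> dist (D2 a b y) (D2 a b x) < \<epsilon>/2" for a b
      using cont[of a b] that unfolding continuous_at_eps_delta by (meson half_gt_zero)
    then obtain d1 d2 where d1: "d1 > 0" "\<And>y. dist y x < d1 \<Longrightarrow> dist (D2 h k y) (D2 h k x) < \<epsilon>/2"
      and d2: "d2 > 0" "\<And>y. dist y x < d2 \<Longrightarrow> dist (D2 k h y) (D2 k h x) < \<epsilon>/2" by metis
    obtain d3 where d3: "d3 > 0" "ball x d3 \<subseteq> S" using assms open_contains_ball by blast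
    \<comment> \<open>\<open>d\<close> is so small that the parallelogram spanned by \<open>d h\<close> and \<open>d k\<close> at \<open>x\<close> lies in the ball of radius \<open>m\<close>.\<close>
    define m where "m = min d1 (min d2 d3)"
    define d where "d = m / 2 / (norm h + norm k + 1)"
    have m: "m > 0" "m \<le> d1" "m \<le> d2" "m \<le> d3" using d1 d2 d3 by (auto simp: m_def)
    have N: "norm h + norm k + 1 > 0" by (smt (verit) norm_ge_zero)
    have d: "d > 0" using m N by (simp add: d_def)
    have close: "dist (x + s *\<^sub>R h + t *\<^sub>R k) x < m"
      if "0 \<le> s" "s \<le> d" "0 \<le> t" "t \<le> d" for s t
    proof -
      have "dist (x + s *\<^sub>R h + t *\<^sub>R k) x \<le> s * norm h + t * norm k"
        using norm_triangle_ineq[of "s *\<^sub>R h" "t *\<^sub>R k"] that by (simp add: dist_norm add.assoc)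
      also have "\<dots> \<le> d * norm h + d * norm k"
        using that by (intro add_mono mult_right_mono) auto
      also have "\<dots> \<le> d * (norm h + norm k + 1)" using d by (simp add: algebra_simps)
      also have "\<dots> = m / 2" using N unfolding d_def by (metis less_irrefl nonzero_eq_divide_eq)
      also have "\<dots> < m" using m by simp
      finally show ?thesis .
    qed
    have inS: "x + s *\<^sub>R h + t *\<^sub>R k \<in> S" if "0 \<le> s" "s \<le> d" "0 \<le> t" "t \<le> d" for s t
      using close[OF that] m d3 by (auto simp: dist_commute)
    obtain s t where st: "0 < s" "s < d" "0 < t" "t < d"
      and 1: "f (x + d *\<^sub>R h + d *\<^sub>R k) - f (x + d *\<^sub>R h) - f (x + d *\<^sub>R k) + f x
       = d\<^sup>2 * D2 h k (x + s *\<^sub>R h + t *\<^sub>R k)"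
      using second_difference_mean_value[OF assms(2) d inS] unfolding D2_def by blast
    have inS': "x + t *\<^sub>R k + s *\<^sub>R h \<in> S" if "0 \<le> t" "t \<le> d" "0 \<le> s" "s \<le> d" for s t
      using inS[OF that(3,4,1,2)] by (simp add: add_ac)
    obtain s' t' where st': "0 < s'" "s' < d" "0 < t'" "t' < d"
      and 2: "f (x + d *\<^sub>R k + d *\<^sub>R h) - f (x + d *\<^sub>R k) - f (x + d *\<^sub>R h) + f x
       = d\<^sup>2 * D2 k h (x + t' *\<^sub>R k + s' *\<^sub>R h)"
      using second_difference_mean_value[OF assms(2) d inS'] unfolding D2_def by blast
    have "d\<^sup>2 * D2 h k (x + s *\<^sub>R h + t *\<^sub>R k) = d\<^sup>2 * D2 k h (x + s' *\<^sub>R h + t' *\<^sub>R k)"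
    proof -
      have swap: "x + b *\<^sub>R k + a *\<^sub>R h = x + a *\<^sub>R h + b *\<^sub>R k" for a b
        by (simp add: add_ac)
      show ?thesis using 1 2 unfolding swap by linarith
    qed
    then have "D2 h k (x + s *\<^sub>R h + t *\<^sub>R k) = D2 k h (x + s' *\<^sub>R h + t' *\<^sub>R k)"
      using d by simp
    moreover have "dist (D2 h k (x + s *\<^sub>R h + t *\<^sub>R k)) (D2 h k x) < \<epsilon>/2"
      using close[of s t] st m by (intro d1) auto
    moreover have "dist (D2 k h (x + s' *\<^sub>R h + t' *\<^sub>R k)) (D2 k h x) < \<epsilon>/2"
      using close[of s' t'] st' m by (intro d2) auto
    ultimately show ?thesis unfolding dist_real_def by linarith
  qed
  from this[of "\<bar>D2 h k x - D2 k h x\<bar>"] show ?thesis by (auto simp: D2_def)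
qed

section \<open>Hessians and compatible entropies\<close>

lemma gradient_eqI: "(f has_derivative f') (at x) \<Longrightarrow> gradient f x $ k = f' (axis k 1)"
  by (simp add: gradient_def flip: frechet_derivative_at)

lemma jacobian_eq_matrix: "(f has_derivative f') (at x) \<Longrightarrow> jacobian f (at x) = matrix f'"
  by (simp add: jacobian_def flip: frechet_derivative_at)

lemma vector_matrix_jacobian_nth:
  fixes A :: "real^'m::finite \<Rightarrow> real^'k::finite"
  assumes "(A has_derivative A') (at x)"
  shows "(g v* jacobian A (at x)) $ k = g \<bullet> A' (axis k 1)"
  by (simp add: jacobian_eq_matrix[OF assms] vector_matrix_mult_def matrix_def inner_vec_def mult.commute)

lemma has_derivative_vec_lambda:
  fixes f :: "'m::finite \<Rightarrow> 'a::real_normed_vector \<Rightarrow> real"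
  assumes "\<And>i. (f i has_derivative f' i) (at x within S)"
  shows "((\<lambda>x. \<chi> i. f i x) has_derivative (\<lambda>h. \<chi> i. f' i h)) (at x within S)"
  by (rule has_derivative_componentwise_within[THEN iffD2])
    (auto simp: Basis_vec_def inner_axis assms)

lemma hessian_nth:
  fixes f :: "real^'m::finite \<Rightarrow> real"
  assumes "open S" "Ck_on 2 S f" "x \<in> S"
  shows "hessian f x $ i $ k
    = frechet_derivative (\<lambda>y. frechet_derivative f (at y) (axis i 1)) (at x) (axis k 1)"
proof -
  have comp: "(\<lambda>y. gradient f y $ i) = (\<lambda>y. frechet_derivative f (at y) (axis i 1))" for i
    by (simp add: gradient_def)
  have "Ck_on 1 S (gradient f)"
    using assms by (intro Ck_on_vec) (auto simp: comp numeral_2_eq_2)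
  then have "(gradient f has_derivative frechet_derivative (gradient f) (at x)) (at x)"
    using assms(3) by (auto simp: frechet_derivative_works)
  then have "((\<lambda>y. gradient f y $ i) has_derivative
      (\<lambda>h. frechet_derivative (gradient f) (at x) h $ i)) (at x)"
    by (rule bounded_linear.has_derivative[OF bounded_linear_vec_nth])
  from fun_cong[OF frechet_derivative_at[OF this], of "axis k 1"] show ?thesis
    unfolding comp by (simp add: hessian_def jacobian_def matrix_def)
qed

lemma hessian_symmetric:
  fixes f :: "real^'m::finite \<Rightarrow> real"
  assumes "open S" "Ck_on 2 S f" "x \<in> S"
  shows "hessian f x $ i $ k = hessian f x $ k $ i"
  unfolding hessian_nth[OF assms] by (rule second_derivative_symmetric[OF assms])

text \<open>The structural reason for the convexity in the theorem. Differentiating the compatibility relation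
  \<open>\<nabla>H = G \<cdot> \<nabla>A\<close> once more gives \<open>\<nabla>\<^sup>2H = G \<cdot> \<nabla>\<^sup>2A + (\<nabla>A)\<^sup>T \<nabla>G\<close>, so the corrected Hessian is the matrix
  \<open>(\<nabla>A)\<^sup>T \<nabla>G\<close>: its quadratic form involves first derivatives of \<open>A\<close> and \<open>G\<close> only, and its symmetry
  is inherited from the Hessians.\<close>

lemma compatible_entropy_hessian:
  fixes H :: "real^'m::finite \<Rightarrow> real" and A G :: "real^'m \<Rightarrow> real^'k::finite"
  assumes S: "open S" "x \<in> S"
    and H: "Ck_on 2 S H" and A: "Ck_on 2 S A"
    and A': "\<And>y. y \<in> S \<Longrightarrow> (A has_derivative A' y) (at y)"
    and G': "(G has_derivative G') (at x)"
    and compat: "\<And>y h. y \<in> S \<Longrightarrow> (H has_derivative (\<lambda>h. G y \<bullet> A' y h)) (at y)"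
  defines "M \<equiv> hessian H x - (\<Sum>j\<in>UNIV. G x $ j *\<^sub>R hessian (\<lambda>y. A y $ j) x)"
  shows "symmetric_matrix M" "h \<bullet> (M *v h) = A' x h \<bullet> G' h"
proof -
  have Aj: "Ck_on 2 S (\<lambda>y. A y $ j)" for j
    using Ck_on_vec_nth[OF S(1) A] .
  have Mnth: "M $ i $ k = hessian H x $ i $ k - (\<Sum>j\<in>UNIV. G x $ j * hessian (\<lambda>y. A y $ j) x $ i $ k)"
    for i k
    by (simp add: M_def)
  show "symmetric_matrix M"
    by (auto simp: symmetric_matrix_def transpose_def vec_eq_iff Mnth
        hessian_symmetric[OF S(1) H S(2)] hessian_symmetric[OF S(1) Aj S(2)])
  have "M $ i $ k = A' x (axis i 1) \<bullet> G' (axis k 1)" for i k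
  proof -
    let ?a = "axis i (1::real)"
    have dAj: "((\<lambda>y. A y $ j) has_derivative (\<lambda>h. A' y h $ j)) (at y)" if "y \<in> S" for y j
      by (rule bounded_linear.has_derivative[OF bounded_linear_vec_nth A'[OF that]])
    have ev: "frechet_derivative (\<lambda>y. A y $ j) (at y) ?a = A' y ?a $ j" if "y \<in> S" for y j
      using fun_cong[OF frechet_derivative_at[OF dAj[OF that]], of ?a] by simp
    have evH: "frechet_derivative H (at y) ?a = (\<Sum>j\<in>UNIV. G y $ j * A' y ?a $ j)" if "y \<in> S" for y
      using fun_cong[OF frechet_derivative_at[OF compat[OF that]], of ?a] by (simp add: inner_vec_def)
    define P where "P j = frechet_derivative (\<lambda>y. frechet_derivative (\<lambda>y. A y $ j) (at y) ?a) (at x)" for j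
    have P: "((\<lambda>y. A' y ?a $ j) has_derivative P j) (at x)" for j
    proof -
      have "((\<lambda>y. frechet_derivative (\<lambda>y. A y $ j) (at y) ?a) has_derivative P j) (at x)"
        using Aj[of j] S(2) unfolding P_def numeral_2_eq_2 frechet_derivative_works[symmetric]
        by simp
      then show ?thesis
        by (rule has_derivative_transform_within_open[OF _ S]) (simp add: ev)
    qed
    have Gj: "((\<lambda>y. G y $ j) has_derivative (\<lambda>h. G' h $ j)) (at x)" for j
      by (rule bounded_linear.has_derivative[OF bounded_linear_vec_nth G'])
    have "((\<lambda>y. \<Sum>j\<in>UNIV. G y $ j * A' y ?a $ j) has_derivative
        (\<lambda>h. \<Sum>j\<in>UNIV. G x $ j * P j h + G' h $ j * A' x ?a $ j)) (at x)"
      by (intro has_derivative_sum has_derivative_mult Gj P)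
    then have "((\<lambda>y. frechet_derivative H (at y) ?a) has_derivative
        (\<lambda>h. \<Sum>j\<in>UNIV. G x $ j * P j h + G' h $ j * A' x ?a $ j)) (at x)"
      by (rule has_derivative_transform_within_open[OF _ S]) (simp add: evH)
    from fun_cong[OF frechet_derivative_at[OF this], of "axis k 1"]
    have "hessian H x $ i $ k = (\<Sum>j\<in>UNIV. G x $ j * P j (axis k 1) + G' (axis k 1) $ j * A' x ?a $ j)"
      unfolding hessian_nth[OF S(1) H S(2)] by (rule sym)
    moreover have "hessian (\<lambda>y. A y $ j) x $ i $ k = P j (axis k 1)" for j
      unfolding hessian_nth[OF S(1) Aj S(2)] P_def ..
    ultimately show ?thesis
      by (simp add: Mnth sum.distrib inner_vec_def mult.commute)
  qed
  then have "M = transpose (matrix (A' x)) ** matrix G'"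
    by (simp add: vec_eq_iff matrix_matrix_mult_def transpose_def matrix_def inner_vec_def)
  then have "h \<bullet> (M *v h) = (matrix (A' x) *v h) \<bullet> (matrix G' *v h)"
    by (simp only: matrix_vector_mul_assoc[symmetric] dot_lmul_matrix[symmetric] vector_transpose_matrix)
  then show "h \<bullet> (M *v h) = A' x h \<bullet> G' h"
    using has_derivative_linear[OF A'[OF S(2)]] has_derivative_linear[OF G'] by (simp add: matrix_works)
qed

section \<open>States\<close>

lemma bounded_linear_dens: "bounded_linear dens"
  and bounded_linear_velo: "bounded_linear velo"
  and bounded_linear_temp: "bounded_linear temp"
  by (auto intro!: linearI simp: linear_conv_bounded_linear[symmetric] dens_def velo_def temp_def vec_eq_iff)

lemma bounded_linear_total_mass: "bounded_linear total_mass"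
  by (auto intro!: linearI simp: linear_conv_bounded_linear[symmetric] total_mass_def sum.distrib sum_distrib_left)

lemma bounded_linear_mass: "bounded_linear mass"
  unfolding mass_def by (rule bounded_linear_compose[OF bounded_linear_total_mass bounded_linear_dens])

lemma bounded_linear_thermo: "bounded_linear thermo"
  unfolding thermo_def by (rule bounded_linear_Pair[OF bounded_linear_dens bounded_linear_temp])

lemmas state_derivative_intros [derivative_intros] =
  bounded_linear.has_derivative[OF bounded_linear_dens]
  bounded_linear.has_derivative[OF bounded_linear_velo]
  bounded_linear.has_derivative[OF bounded_linear_temp]
  bounded_linear.has_derivative[OF bounded_linear_mass]
  bounded_linear.has_derivative[OF bounded_linear_thermo]
  bounded_linear.has_derivative[OF bounded_linear_vec_nth]

lemma stack_sel [simp]: "dens (stack r v s) = r" "velo (stack r v s) = v" "temp (stack r v s) = s"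
  by (simp_all add: dens_def velo_def temp_def stack_def vec_eq_iff)

lemma state_zero [simp]: "dens 0 = 0" "velo 0 = 0" "temp 0 = 0"
  by (simp_all add: dens_def velo_def temp_def vec_eq_iff)

lemma state_scaleR [simp]:
  "dens (c *\<^sub>R U) = c *\<^sub>R dens U" "velo (c *\<^sub>R U) = c *\<^sub>R velo U" "temp (c *\<^sub>R U) = c * temp U"
  by (simp_all add: dens_def velo_def temp_def vec_eq_iff)

lemma state_index_cases:
  obtains (dens) i where "k = Inl i" | (velo) j where "k = Inr (Inl j)"
  | (temp) "k = Inr (Inr (1 :: 1))"
  by (metis num1_eq1 sum.exhaust)

lemma state_eqI:
  assumes "dens U = dens V" "velo U = velo V" "temp U = temp V"
  shows "U = V"
proof -
  have "U $ k = V $ k" for k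
    using assms by (cases k rule: state_index_cases) (auto simp: dens_def velo_def temp_def vec_eq_iff)
  then show ?thesis by (simp add: vec_eq_iff)
qed

lemma sum_state_index:
  "(\<Sum>k\<in>UNIV. g (k :: 'n::finite + 3 + 1)) =
     (\<Sum>i\<in>UNIV. g (Inl i)) + (\<Sum>j\<in>UNIV. g (Inr (Inl j))) + (g (Inr (Inr 1)) :: real)"
  unfolding UNIV_Plus_UNIV[symmetric] by (simp add: sum.Plus UNIV_Plus_UNIV[symmetric] del: UNIV_Plus_UNIV)

lemma inner_state: "U \<bullet> V = dens U \<bullet> dens V + velo U \<bullet> velo V + temp U * temp V"
  by (simp add: inner_vec_def sum_state_index dens_def velo_def temp_def)

lemma bounded_linear_stack: "bounded_linear (\<lambda>(r, v, s). stack r v s)"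
  by (auto intro!: linearI state_eqI simp: linear_conv_bounded_linear[symmetric] split_beta
     linear_simps[OF bounded_linear_dens] linear_simps[OF bounded_linear_velo] linear_simps[OF bounded_linear_temp])

lemma has_derivative_stack [derivative_intros]:
  assumes "(r has_derivative r') (at x within T)" "(v has_derivative v') (at x within T)"
    "(s has_derivative s') (at x within T)"
  shows "((\<lambda>x. stack (r x) (v x) (s x)) has_derivative (\<lambda>h. stack (r' h) (v' h) (s' h))) (at x within T)"
  using bounded_linear.has_derivative[OF bounded_linear_stack has_derivative_Pair[OF assms(1) has_derivative_Pair[OF assms(2,3)]]]
  by simp

lemma open_thermo_domain: "open (thermo_domain :: ((real^'n::finite) \<times> real) set)"
proof -
  have eq: "(thermo_domain :: ((real^'n) \<times> real) set) = (\<Inter>i. {w. 0 < fst w $ i}) \<inter> {w. 0 < snd w}"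
    by (auto simp: thermo_domain_def)
  have "open {w :: (real^'n) \<times> real. 0 < fst w $ i}" for i
    by (intro open_Collect_less continuous_on_const continuous_on_component continuous_on_fst continuous_on_id)
  moreover have "open {w :: (real^'n) \<times> real. 0 < snd w}"
    by (intro open_Collect_less continuous_on_const continuous_on_snd continuous_on_id)
  ultimately show ?thesis unfolding eq by (intro open_Int open_INT) auto
qed

lemma state_domain_vimage: "state_domain = thermo -` thermo_domain"
  by (auto simp: state_domain_def thermo_def thermo_domain_def)

lemma open_state_domain: "open (state_domain :: (real^('n::finite + 3 + 1)) set)"
  unfolding state_domain_vimage
  by (intro open_vimage open_thermo_domain linear_continuous_on bounded_linear_thermo)

lemma total_mass_pos: "w \<in> thermo_domain \<Longrightarrow> 0 < total_mass (fst (w :: (real^'n::finite) \<times> real))"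
  by (auto simp: thermo_domain_def total_mass_def intro: sum_pos)

lemma mass_pos: "U \<in> state_domain \<Longrightarrow> 0 < mass (U :: real^('n::finite + 3 + 1))"
  using total_mass_pos[of "thermo U"] by (simp add: state_domain_vimage thermo_def mass_def)

lemma temp_pos: "U \<in> state_domain \<Longrightarrow> 0 < temp U"
  by (simp add: state_domain_def)

lemma Ck_on_thermo: "Ck_on k thermo_domain f \<Longrightarrow> Ck_on k state_domain (\<lambda>U. f (thermo U))"
  unfolding state_domain_vimage by (rule Ck_on_precompose_linear[OF open_thermo_domain bounded_linear_thermo])

section \<open>Thermodynamics\<close>

text \<open>The pressure, the chemical potentials, and the entropy and energy per volume are obtained from the
  free energy by differentiation and multiplication, so they lose one derivative and are \<open>C\<^sup>2\<close>. The
  densities \<open>entropy\<close> and \<open>energy\<close> per volume are used in place of \<open>\<eta>\<close> and \<open>e\<close> because the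
  relations give them without a division by the total mass.\<close>

locale gibbs_relations =
  fixes \<psi> \<eta> e p :: "(real^'n::finite) \<times> real \<Rightarrow> real"
    and \<mu> :: "'n \<Rightarrow> (real^'n) \<times> real \<Rightarrow> real"
  assumes smooth: "Ck_on 3 thermo_domain \<psi>"
    and relations: "thermodynamic_relations \<psi> \<eta> e \<mu> p"
begin

definition entropy :: "(real^'n) \<times> real \<Rightarrow> real" where
  "entropy w = total_mass (fst w) * \<eta> w"

definition energy :: "(real^'n) \<times> real \<Rightarrow> real" where
  "energy w = total_mass (fst w) * e w"

abbreviation d_entropy :: "(real^'n) \<times> real \<Rightarrow> (real^'n) \<times> real \<Rightarrow> real" where
  "d_entropy w \<equiv> frechet_derivative entropy (at w)"

abbreviation d_potential :: "'n \<Rightarrow> (real^'n) \<times> real \<Rightarrow> (real^'n) \<times> real \<Rightarrow> real" where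
  "d_potential i w \<equiv> frechet_derivative (\<mu> i) (at w)"

abbreviation d_pressure :: "(real^'n) \<times> real \<Rightarrow> (real^'n) \<times> real \<Rightarrow> real" where
  "d_pressure w \<equiv> frechet_derivative p (at w)"

lemma
  assumes "w \<in> thermo_domain"
  shows entropy_eq: "entropy w = - pd_theta (free_energy \<psi>) w"
    and energy_eq: "energy w = free_energy \<psi> w + snd w * entropy w"
    and potential_eq: "\<mu> i w = pd_rho i (free_energy \<psi>) w"
    and pressure_eq: "p w = (\<Sum>i\<in>UNIV. fst w $ i * \<mu> i w) - free_energy \<psi> w"
  using bspec[OF relations[unfolded thermodynamic_relations_def] assms]
  by (auto simp: entropy_def energy_def split: prod.splits)

lemma Ck_free_energy: "Ck_on 3 thermo_domain (free_energy \<psi>)"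
  unfolding free_energy_def
  by (intro Ck_on_mult Ck_on_linear smooth open_thermo_domain
      bounded_linear_compose[OF bounded_linear_total_mass bounded_linear_fst])

lemma Ck_free_energy_derivative:
  "Ck_on 2 thermo_domain (\<lambda>w. frechet_derivative (free_energy \<psi>) (at w) h)"
  using Ck_free_energy by (intro Ck_on_Suc_derivative) (simp add: numeral_3_eq_3 numeral_2_eq_2)

lemma Ck_entropy: "Ck_on 2 thermo_domain entropy"
  using Ck_on_uminus[OF open_thermo_domain Ck_free_energy_derivative[of "(0, 1)"]]
  by (subst Ck_on_cong[OF open_thermo_domain entropy_eq]) (auto simp: pd_theta_def)

lemma Ck_potential: "Ck_on 2 thermo_domain (\<mu> i)"
  using Ck_free_energy_derivative[of "(axis i 1, 0)"]
  by (subst Ck_on_cong[OF open_thermo_domain potential_eq]) (auto simp: pd_rho_def[abs_def])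

lemma Ck_energy: "Ck_on 2 thermo_domain energy"
proof -
  have "Ck_on 2 thermo_domain (\<lambda>w. free_energy \<psi> w + snd w * entropy w)"
    by (intro Ck_on_add Ck_on_mult open_thermo_domain Ck_entropy Ck_on_mono[OF Ck_free_energy]
        Ck_on_linear bounded_linear_snd) simp
  then show ?thesis by (subst Ck_on_cong[OF open_thermo_domain energy_eq]) auto
qed

lemma Ck_pressure: "Ck_on 2 thermo_domain p"
proof -
  have "Ck_on 2 thermo_domain (\<lambda>w. (\<Sum>i\<in>UNIV. fst w $ i * \<mu> i w) - free_energy \<psi> w)"
    by (intro Ck_on_diff Ck_on_sum Ck_on_mult open_thermo_domain Ck_potential Ck_on_mono[OF Ck_free_energy]
        Ck_on_linear bounded_linear_compose[OF bounded_linear_vec_nth bounded_linear_fst]) simp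
  then show ?thesis by (subst Ck_on_cong[OF open_thermo_domain pressure_eq]) auto
qed

lemma C2_has_derivative:
  assumes "Ck_on 2 thermo_domain f" "w \<in> thermo_domain"
  shows "(f has_derivative frechet_derivative f (at w)) (at w)"
  using assms by (auto simp: numeral_2_eq_2 frechet_derivative_works)

lemma thermo_vector_decomp: "h = (\<Sum>i\<in>UNIV. (fst h $ i) *\<^sub>R (axis i 1, 0)) + snd h *\<^sub>R (0, 1 :: real)"
  for h :: "(real^'n) \<times> real"
proof (rule prod_eqI)
  have "fst (\<Sum>i\<in>UNIV. (fst h $ i) *\<^sub>R (axis i 1 :: real^'n, 0::real)) = (\<Sum>i\<in>UNIV. (fst h $ i) *\<^sub>R axis i 1)"
    by (subst fst_sum) simp
  also have "\<dots> = fst h" by (simp add: vec_eq_iff axis_def if_distrib sum.delta cong: if_cong)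
  finally show "fst h = fst ((\<Sum>i\<in>UNIV. (fst h $ i) *\<^sub>R (axis i 1, 0)) + snd h *\<^sub>R (0, 1 :: real))"
    by simp
qed (simp add: snd_sum)

lemma thermo_linear_decomp:
  fixes L :: "(real^'n) \<times> real \<Rightarrow> real"
  assumes "linear L"
  shows "L h = (\<Sum>i\<in>UNIV. fst h $ i * L (axis i 1, 0)) + snd h * L (0, 1)"
proof -
  interpret linear L by (rule assms)
  show ?thesis
    by (subst thermo_vector_decomp) (simp only: add sum scale real_scaleR_def)
qed

text \<open>The Gibbs relation: the thermodynamic relations prescribe exactly these partial derivatives.\<close>

lemma free_energy_has_derivative:
  assumes "w \<in> thermo_domain"
  shows "(free_energy \<psi> has_derivative (\<lambda>h. (\<Sum>i\<in>UNIV. fst h $ i * \<mu> i w) - snd h * entropy w)) (at w)"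
proof -
  let ?L = "frechet_derivative (free_energy \<psi>) (at w)"
  have d: "(free_energy \<psi> has_derivative ?L) (at w)"
    by (rule C2_has_derivative[OF Ck_on_mono[OF Ck_free_energy] assms]) simp
  have "?L h = (\<Sum>i\<in>UNIV. fst h $ i * \<mu> i w) - snd h * entropy w" for h
    using thermo_linear_decomp[OF has_derivative_linear[OF d], of h] entropy_eq[OF assms] potential_eq[OF assms]
    by (simp add: pd_rho_def pd_theta_def)
  then have "?L = (\<lambda>h. (\<Sum>i\<in>UNIV. fst h $ i * \<mu> i w) - snd h * entropy w)" by blast
  then show ?thesis using d by simp
qed

text \<open>In \<open>\<rho>e = \<rho>\<psi> + \<theta> \<rho>\<eta>\<close> the terms \<open>\<rho>\<eta> d\<theta>\<close> cancel, leaving \<open>d(\<rho>e) = \<Sum>\<^sub>i \<mu>\<^sub>i d\<rho>\<^sub>i + \<theta> d(\<rho>\<eta>)\<close>.\<close>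

lemma energy_has_derivative:
  assumes "w \<in> thermo_domain"
  shows "(energy has_derivative (\<lambda>h. (\<Sum>i\<in>UNIV. fst h $ i * \<mu> i w) + snd w * d_entropy w h)) (at w)"
proof -
  have "((\<lambda>w. free_energy \<psi> w + snd w * entropy w) has_derivative
      (\<lambda>h. (\<Sum>i\<in>UNIV. fst h $ i * \<mu> i w) + snd w * d_entropy w h)) (at w)"
    by (rule derivative_eq_intros free_energy_has_derivative C2_has_derivative Ck_entropy assms | simp add: algebra_simps)+
  then show ?thesis
    by (rule has_derivative_transform_within_open[OF _ open_thermo_domain assms]) (simp add: energy_eq)
qed

text \<open>Both sides are, up to sign, the mixed second derivative of the free energy in \<open>\<rho>\<^sub>i\<close> and \<open>\<theta>\<close>.\<close>

lemma maxwell_relation: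
  assumes "w \<in> thermo_domain"
  shows "d_entropy w (axis i 1, 0) = - d_potential i w (0, 1)"
proof -
  let ?f = "free_energy \<psi>"
  have *: "frechet_derivative g (at w) = frechet_derivative f (at w)"
    if "\<And>w. w \<in> thermo_domain \<Longrightarrow> f w = g w" "Ck_on 2 thermo_domain f" for f g :: "(real^'n) \<times> real \<Rightarrow> real"
    by (rule frechet_derivative_transform_within_open[OF _ open_thermo_domain assms, symmetric])
      (use that assms in \<open>auto simp: numeral_2_eq_2\<close>)
  have 1: "d_potential i w = frechet_derivative (\<lambda>w. frechet_derivative ?f (at w) (axis i 1, 0)) (at w)"
    by (rule *) (auto simp: potential_eq pd_rho_def Ck_free_energy_derivative)
  have 2: "frechet_derivative (\<lambda>w. - entropy w) (at w) = frechet_derivative (\<lambda>w. frechet_derivative ?f (at w) (0, 1)) (at w)"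
    by (rule *) (auto simp: entropy_eq pd_theta_def Ck_free_energy_derivative)
  have 3: "frechet_derivative (\<lambda>w. - entropy w) (at w) = (\<lambda>h. - d_entropy w h)"
    by (intro frechet_derivative_at[symmetric] has_derivative_minus C2_has_derivative Ck_entropy assms)
  have "Ck_on 2 thermo_domain ?f" by (rule Ck_on_mono[OF Ck_free_energy]) simp
  from second_derivative_symmetric[OF open_thermo_domain this assms, of "(axis i 1, 0)" "(0, 1)"]
  show ?thesis
    unfolding 1 using fun_cong[OF 2, of "(axis i 1, 0)"] fun_cong[OF 3, of "(axis i 1, 0)"] by linarith
qed

text \<open>The energy derivative at fixed densities, computed in two ways: \<open>\<theta> (\<rho>\<eta>)\<^sub>\<theta> = (\<rho>e)\<^sub>\<theta> = \<rho> e\<^sub>\<theta>\<close>.\<close>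

lemma heat_capacity:
  assumes "w \<in> thermo_domain"
  shows "snd w * d_entropy w (0, 1) = total_mass (fst w) * pd_theta e w"
proof -
  have m: "total_mass (fst w) > 0" by (rule total_mass_pos[OF assms])
  have tm: "((\<lambda>w::(real^'n) \<times> real. total_mass (fst w)) has_derivative (\<lambda>h. total_mass (fst h))) (at w)"
    by (rule bounded_linear_imp_has_derivative[OF bounded_linear_compose[OF bounded_linear_total_mass bounded_linear_fst]])
  have "(\<lambda>w. energy w / total_mass (fst w)) differentiable (at w)"
    using has_derivative_divide'[OF energy_has_derivative[OF assms] tm] m by (auto intro: differentiableI)
  then obtain e' where "((\<lambda>w. energy w / total_mass (fst w)) has_derivative e') (at w)"
    by (auto simp: differentiable_def)
  then have "(e has_derivative e') (at w)"
    by (rule has_derivative_transform_within_open[OF _ open_thermo_domain assms])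
      (use total_mass_pos in \<open>force simp: energy_def\<close>)
  then have e': "(e has_derivative frechet_derivative e (at w)) (at w)"
    by (metis frechet_derivative_at)
  have "(energy has_derivative (\<lambda>h. total_mass (fst w) * frechet_derivative e (at w) h + total_mass (fst h) * e w)) (at w)"
    unfolding energy_def[abs_def] by (rule has_derivative_mult[OF tm e'])
  from has_derivative_unique[OF this energy_has_derivative[OF assms], THEN fun_cong, of "(0, 1)"]
  show ?thesis
    by (simp add: pd_theta_def total_mass_def)
qed

text \<open>By the Maxwell relation the terms mixing \<open>d\<rho>\<^sub>i\<close> and \<open>d\<theta>\<close> cancel, so the form splits into the Hessian of
  the free energy in the densities and \<open>(\<rho> e\<^sub>\<theta> / \<theta>) d\<theta>\<^sup>2\<close>. These are the two stability hypotheses.\<close>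

lemma thermodynamic_stability:
  assumes "w \<in> thermo_domain" "0 < pd_theta e w"
    and pd: "positive_definite (\<chi> i j. pd_rho j (pd_rho i (free_energy \<psi>)) w)"
    and "h \<noteq> 0"
  shows "0 < (\<Sum>i\<in>UNIV. fst h $ i * d_potential i w h) + snd h * d_entropy w h"
proof -
  let ?K = "\<chi> i j. pd_rho j (pd_rho i (free_energy \<psi>)) w"
  have K: "?K $ i $ j = d_potential i w (axis j 1, 0)" for i j
  proof -
    have "frechet_derivative (\<mu> i) (at w) = frechet_derivative (pd_rho i (free_energy \<psi>)) (at w)"
      by (rule frechet_derivative_transform_within_open[OF _ open_thermo_domain assms(1)])
        (use Ck_potential[of i] assms(1) in \<open>auto simp: numeral_2_eq_2 potential_eq\<close>)
    then show ?thesis by (simp add: pd_rho_def)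
  qed
  have cross: "(\<Sum>i\<in>UNIV. fst h $ i * d_potential i w h)
      = fst h \<bullet> (?K *v fst h) + snd h * (\<Sum>i\<in>UNIV. fst h $ i * d_potential i w (0, 1))"
    unfolding thermo_linear_decomp[OF has_derivative_linear[OF C2_has_derivative[OF Ck_potential assms(1)]], of _ h]
    by (simp add: inner_vec_def matrix_vector_mult_def K[simplified] sum.distrib sum_distrib_left algebra_simps)
  have dS: "d_entropy w h = - (\<Sum>i\<in>UNIV. fst h $ i * d_potential i w (0, 1)) + snd h * d_entropy w (0, 1)"
    unfolding thermo_linear_decomp[OF has_derivative_linear[OF C2_has_derivative[OF Ck_entropy assms(1)]], of h]
    by (simp add: maxwell_relation[OF assms(1)] sum_negf)
  have eq: "(\<Sum>i\<in>UNIV. fst h $ i * d_potential i w h) + snd h * d_entropy w h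
      = fst h \<bullet> (?K *v fst h) + d_entropy w (0, 1) * (snd h)\<^sup>2"
    unfolding cross dS by (simp add: algebra_simps power2_eq_square)
  have "0 < snd w" using assms(1) by (auto simp: thermo_domain_def)
  moreover have "0 < snd w * d_entropy w (0, 1)"
    unfolding heat_capacity[OF assms(1)] using total_mass_pos[OF assms(1)] assms(2) by simp
  ultimately have c: "0 < d_entropy w (0, 1)" by (simp add: zero_less_mult_iff)
  show ?thesis
  proof (cases "fst h = 0")
    case True
    then have "snd h \<noteq> 0" using assms(4) by (auto simp: prod_eq_iff)
    then show ?thesis unfolding eq using True c by simp
  next
    case False
    then have "0 < fst h \<bullet> (?K *v fst h)" using pd by (auto simp: positive_definite_def)
    moreover have "0 \<le> d_entropy w (0, 1) * (snd h)\<^sup>2" using c by simp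
    ultimately show ?thesis unfolding eq by linarith
  qed
qed

section \<open>Conserved quantities, fluxes and entropy variables\<close>

text \<open>The derivatives of \<open>A_map\<close> and \<open>F_map\<close> at \<open>U\<close> in the direction \<open>h\<close>. The energy component
  uses the Gibbs relation, the form in which the pairing with \<open>G\<close> cancels.\<close>

definition d_conserved :: "real^('n + 3 + 1) \<Rightarrow> real^('n + 3 + 1) \<Rightarrow> real^('n + 3 + 1)" where
  "d_conserved U h = stack (dens h) (mass h *\<^sub>R velo U + mass U *\<^sub>R velo h)
     ((\<Sum>i\<in>UNIV. dens h $ i * \<mu> i (thermo U)) + temp U * d_entropy (thermo U) (thermo h)
      + 1/2 * mass h * (velo U \<bullet> velo U) + mass U * (velo U \<bullet> velo h))"

definition d_flux :: "3 \<Rightarrow> real^('n + 3 + 1) \<Rightarrow> real^('n + 3 + 1) \<Rightarrow> real^('n + 3 + 1)" where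
  "d_flux \<alpha> U h = stack (velo h $ \<alpha> *\<^sub>R dens U + velo U $ \<alpha> *\<^sub>R dens h)
     (velo U $ \<alpha> *\<^sub>R (mass h *\<^sub>R velo U + mass U *\<^sub>R velo h) + velo h $ \<alpha> *\<^sub>R (mass U *\<^sub>R velo U)
       + d_pressure (thermo U) (thermo h) *\<^sub>R axis \<alpha> 1)
     (velo U $ \<alpha> * (temp (d_conserved U h) + d_pressure (thermo U) (thermo h))
       + velo h $ \<alpha> * (total_energy e U + p (thermo U)))"

lemma thermo_in_domain: "U \<in> state_domain \<Longrightarrow> thermo U \<in> thermo_domain"
  by (simp add: state_domain_vimage)

lemma thermo_sel [simp]: "fst (thermo U) = dens U" "snd (thermo U) = temp U"
  by (simp_all add: thermo_def)

lemma entropy_thermo: "entropy (thermo U) = mass U * \<eta> (thermo U)"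
  and total_energy_eq: "total_energy e U = energy (thermo U) + 1/2 * mass U * (velo U \<bullet> velo U)"
  by (simp_all add: entropy_def energy_def total_energy_def mass_def power2_norm_eq_inner)

lemma thermo_chain:
  "(f has_derivative f') (at (thermo U)) \<Longrightarrow> ((\<lambda>V. f (thermo V)) has_derivative (\<lambda>h. f' (thermo h))) (at U)"
  by (rule has_derivative_compose[OF bounded_linear_imp_has_derivative[OF bounded_linear_thermo]])

lemma C2_thermo_has_derivative:
  assumes "Ck_on 2 thermo_domain f" "U \<in> state_domain"
  shows "((\<lambda>V. f (thermo V)) has_derivative (\<lambda>h. frechet_derivative f (at (thermo U)) (thermo h))) (at U)"
  by (rule thermo_chain[OF C2_has_derivative[OF assms(1) thermo_in_domain[OF assms(2)]]])

lemma total_energy_has_derivative: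
  assumes "U \<in> state_domain"
  shows "(total_energy e has_derivative (\<lambda>h. temp (d_conserved U h))) (at U)"
  unfolding total_energy_eq[abs_def] d_conserved_def stack_sel
  using thermo_chain[OF energy_has_derivative[OF thermo_in_domain[OF assms]]]
  by (auto intro!: derivative_eq_intros simp: fun_eq_iff inner_commute algebra_simps)

lemma conserved_has_derivative:
  assumes "U \<in> state_domain"
  shows "(A_map e has_derivative d_conserved U) (at U)"
proof -
  have "((\<lambda>V. stack (dens V) (mass V *\<^sub>R velo V) (total_energy e V)) has_derivative
      (\<lambda>h. stack (dens h) (mass U *\<^sub>R velo h + mass h *\<^sub>R velo U) (temp (d_conserved U h)))) (at U)"
    by (intro derivative_intros total_energy_has_derivative assms)
  moreover have "(\<lambda>h. stack (dens h) (mass U *\<^sub>R velo h + mass h *\<^sub>R velo U) (temp (d_conserved U h)))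
      = d_conserved U"
    by (simp add: d_conserved_def fun_eq_iff add.commute)
  ultimately show ?thesis by (simp add: A_map_def[abs_def])
qed

lemma flux_eq_stack:
  "F_map e p \<alpha> U = stack (velo U $ \<alpha> *\<^sub>R dens U)
     (velo U $ \<alpha> *\<^sub>R (mass U *\<^sub>R velo U) + p (thermo U) *\<^sub>R axis \<alpha> 1)
     (velo U $ \<alpha> * (total_energy e U + p (thermo U)))"
  unfolding F_map_def by (rule state_eqI) (simp_all add: vec_eq_iff axis_def)

lemma flux_has_derivative:
  assumes "U \<in> state_domain"
  shows "(F_map e p \<alpha> has_derivative d_flux \<alpha> U) (at U)"
proof -
  have "((\<lambda>V. stack (velo V $ \<alpha> *\<^sub>R dens V)
     (velo V $ \<alpha> *\<^sub>R (mass V *\<^sub>R velo V) + p (thermo V) *\<^sub>R axis \<alpha> 1)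
     (velo V $ \<alpha> * (total_energy e V + p (thermo V)))) has_derivative
      (\<lambda>h. stack (velo U $ \<alpha> *\<^sub>R dens h + velo h $ \<alpha> *\<^sub>R dens U)
       (velo U $ \<alpha> *\<^sub>R (mass U *\<^sub>R velo h + mass h *\<^sub>R velo U) + velo h $ \<alpha> *\<^sub>R (mass U *\<^sub>R velo U)
       + d_pressure (thermo U) (thermo h) *\<^sub>R axis \<alpha> 1)
       (velo U $ \<alpha> * (temp (d_conserved U h) + d_pressure (thermo U) (thermo h))
         + velo h $ \<alpha> * (total_energy e U + p (thermo U))))) (at U)"
    by (intro derivative_intros has_derivative_scaleR_left total_energy_has_derivative
        C2_thermo_has_derivative Ck_pressure assms)
  then show ?thesis
    by (simp add: flux_eq_stack[abs_def] d_flux_def[abs_def] add.commute)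
qed

lemma entropy_has_derivative:
  assumes "U \<in> state_domain"
  shows "(H_fun \<eta> has_derivative (\<lambda>h. - d_entropy (thermo U) (thermo h))) (at U)"
  unfolding H_fun_def[abs_def] entropy_thermo[symmetric]
  by (intro derivative_intros C2_thermo_has_derivative Ck_entropy assms)

lemma entropy_flux_has_derivative:
  assumes "U \<in> state_domain"
  shows "(Q_fun \<eta> \<alpha> has_derivative
    (\<lambda>h. - (entropy (thermo U) * velo h $ \<alpha> + d_entropy (thermo U) (thermo h) * velo U $ \<alpha>))) (at U)"
  unfolding Q_fun_def[abs_def] entropy_thermo[symmetric]
  by (intro derivative_intros C2_thermo_has_derivative Ck_entropy assms)

lemma Ck_conserved: "Ck_on 2 state_domain (A_map e)"
proof (rule Ck_on_vec[OF open_state_domain])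
  fix k :: "'n + 3 + 1"
  show "Ck_on 2 state_domain (\<lambda>U. A_map e U $ k)"
  proof (cases k rule: state_index_cases)
    case (dens i)
    have "(\<lambda>U. A_map e U $ k) = (\<lambda>U. U $ k)"
      by (simp add: dens A_map_def stack_def dens_def)
    then show ?thesis by (simp add: Ck_on_linear[OF open_state_domain bounded_linear_vec_nth])
  next
    case (velo j)
    have "(\<lambda>U. A_map e U $ k) = (\<lambda>U. mass U * U $ k)"
      by (simp add: velo A_map_def stack_def velo_def)
    then show ?thesis
      by (simp add: Ck_on_mult Ck_on_linear open_state_domain bounded_linear_vec_nth bounded_linear_mass)
  next
    case temp
    have "(\<lambda>U. A_map e U $ k)
        = (\<lambda>U. energy (thermo U) + mass U * (1/2) * (\<Sum>j\<in>UNIV. U $ Inr (Inl j) * U $ Inr (Inl j)))"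
      by (simp add: temp A_map_def stack_def total_energy_eq velo_def inner_vec_def)
    then show ?thesis
      by (simp only:) (intro Ck_on_add Ck_on_mult Ck_on_sum open_state_domain Ck_on_thermo Ck_energy
          Ck_on_const Ck_on_linear[OF open_state_domain bounded_linear_vec_nth]
          Ck_on_linear[OF open_state_domain bounded_linear_mass])
  qed
qed

lemma Ck_entropy_density: "Ck_on 2 state_domain (H_fun \<eta>)"
  unfolding H_fun_def[abs_def] entropy_thermo[symmetric]
  by (intro Ck_on_uminus Ck_on_thermo Ck_entropy open_state_domain)

text \<open>Multiplying by the temperature keeps the compatibility computations free of denominators.\<close>

lemma inner_entropy_variable:
  "temp U \<noteq> 0 \<Longrightarrow> temp U * (G_map \<mu> U \<bullet> stack r v s)
     = (\<Sum>i\<in>UNIV. r $ i * \<mu> i (thermo U)) - 1/2 * (velo U \<bullet> velo U) * total_mass r + velo U \<bullet> v - s"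
  by (simp add: G_map_def inner_state inner_vec_def[of _ r] power2_norm_eq_inner total_mass_def
      sum_subtractf sum_distrib_left sum_distrib_right algebra_simps)

text \<open>Pairing with \<open>\<theta> G\<close> removes the kinetic contributions and turns \<open>dA\<close> into \<open>\<Sum>\<^sub>i \<mu>\<^sub>i d\<rho>\<^sub>i - d(\<rho>e)\<close>, which is
  \<open>- \<theta> d(\<rho>\<eta>)\<close>.\<close>

lemma entropy_compatible:
  assumes "U \<in> state_domain"
  shows "G_map \<mu> U \<bullet> d_conserved U h = - d_entropy (thermo U) (thermo h)"
proof -
  have t: "temp U > 0" using assms by (rule temp_pos)
  have "temp U * (G_map \<mu> U \<bullet> d_conserved U h) = temp U * (- d_entropy (thermo U) (thermo h))"
    unfolding d_conserved_def using t
    by (simp add: inner_entropy_variable mass_def[symmetric] inner_add_right algebra_simps)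
  then show ?thesis using t mult_left_cancel[of "temp U"] by (metis less_irrefl)
qed

text \<open>The flux is the conserved vector transported with velocity \<open>v\<^sub>\<alpha>\<close>, plus pressure terms. In the terms
  with \<open>dv\<^sub>\<alpha>\<close> the Euler relation \<open>\<rho>e - \<theta> \<rho>\<eta> + p = \<Sum>\<^sub>i \<rho>\<^sub>i \<mu>\<^sub>i\<close> leaves just the entropy; the terms with
  \<open>dp\<close> cancel between the momentum and the energy flux.\<close>

lemma entropy_flux_compatible:
  assumes "U \<in> state_domain"
  shows "G_map \<mu> U \<bullet> d_flux \<alpha> U h
    = - (entropy (thermo U) * velo h $ \<alpha> + d_entropy (thermo U) (thermo h) * velo U $ \<alpha>)"
proof -
  have t: "temp U > 0" using assms by (rule temp_pos)
  have w: "thermo U \<in> thermo_domain" using assms by (rule thermo_in_domain)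
  have gibbs: "(\<Sum>i\<in>UNIV. dens U $ i * \<mu> i (thermo U)) = energy (thermo U) - temp U * entropy (thermo U) + p (thermo U)"
    using pressure_eq[OF w] energy_eq[OF w] by simp
  have tm: "total_mass (a *\<^sub>R x + b *\<^sub>R y) = a * total_mass x + b * total_mass y" for a b and x y :: "real^'n"
    by (simp add: linear_simps[OF bounded_linear_total_mass])
  have sums: "(\<Sum>i\<in>UNIV. (a *\<^sub>R x + b *\<^sub>R y) $ i * \<mu> i (thermo U))
      = a * (\<Sum>i\<in>UNIV. x $ i * \<mu> i (thermo U)) + b * (\<Sum>i\<in>UNIV. y $ i * \<mu> i (thermo U))" for a b and x y :: "real^'n"
    by (simp add: sum.distrib sum_distrib_left algebra_simps)
  have "temp U * (G_map \<mu> U \<bullet> d_flux \<alpha> U h)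
    = temp U * - (entropy (thermo U) * velo h $ \<alpha> + d_entropy (thermo U) (thermo h) * velo U $ \<alpha>)"
    unfolding d_flux_def inner_entropy_variable[OF less_imp_neq[OF t, symmetric]] sums tm gibbs total_energy_eq
    by (simp add: d_conserved_def mass_def[symmetric] inner_add_right inner_axis algebra_simps)
  then show ?thesis using t mult_left_cancel[of "temp U"] by (metis less_irrefl)
qed

lemma entropy_variable_has_derivative:
  assumes "U \<in> state_domain"
  shows "(G_map \<mu> has_derivative (\<lambda>h. (1 / temp U) *\<^sub>R
      stack (\<chi> i. d_potential i (thermo U) (thermo h) - velo U \<bullet> velo h) (velo h) 0
      - (temp h / temp U) *\<^sub>R G_map \<mu> U)) (at U)"
proof -
  have t: "temp U \<noteq> 0" using temp_pos[OF assms] by simp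
  have pot: "((\<lambda>V. (\<chi> i. \<mu> i (thermo V) - 1/2 * (norm (velo V))\<^sup>2)) has_derivative
      (\<lambda>h. \<chi> i. d_potential i (thermo U) (thermo h) - velo U \<bullet> velo h)) (at U)"
    unfolding power2_norm_eq_inner
    by (rule has_derivative_vec_lambda)
      (auto intro!: derivative_eq_intros C2_thermo_has_derivative Ck_potential assms simp: fun_eq_iff inner_commute)
  have "((\<lambda>V. 1 / temp V) has_derivative (\<lambda>h. - (temp h / (temp U)\<^sup>2))) (at U)"
    using t by (auto intro!: derivative_eq_intros simp: fun_eq_iff power2_eq_square)
  from has_derivative_scaleR[OF this has_derivative_stack[OF pot
      bounded_linear_imp_has_derivative[OF bounded_linear_velo] has_derivative_const[of "-1"]]]
  show ?thesis
    unfolding G_map_def[abs_def] by (simp add: power2_eq_square)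
qed

text \<open>Writing \<open>G = B / \<theta>\<close> gives \<open>\<theta> dA \<cdot> dG = dA \<cdot> dB - d\<theta> (G \<cdot> dA)\<close>. The first term is
  \<open>\<Sum>\<^sub>i d\<rho>\<^sub>i d\<mu>\<^sub>i + \<rho> |dv|\<^sup>2\<close> and the second is \<open>d\<theta> d(\<rho>\<eta>)\<close> by compatibility; together they are the
  thermodynamic form plus the kinetic part.\<close>

lemma entropy_quadratic_form_pos:
  assumes "U \<in> state_domain" "0 < pd_theta e (thermo U)"
    and pd: "positive_definite (\<chi> i j. pd_rho j (pd_rho i (free_energy \<psi>)) (thermo U))"
    and "h \<noteq> 0" and G': "(G_map \<mu> has_derivative G') (at U)"
  shows "0 < d_conserved U h \<bullet> G' h"
proof -
  let ?c = "(\<Sum>i\<in>UNIV. dens h $ i * d_potential i (thermo U) (thermo h)) + temp h * d_entropy (thermo U) (thermo h)"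
  have t: "temp U > 0" and m: "mass U > 0" using assms(1) by (auto intro: temp_pos mass_pos)
  have G'_eq: "G' h = (1 / temp U) *\<^sub>R
      stack (\<chi> i. d_potential i (thermo U) (thermo h) - velo U \<bullet> velo h) (velo h) 0
      - (temp h / temp U) *\<^sub>R G_map \<mu> U"
    using has_derivative_unique[OF G' entropy_variable_has_derivative[OF assms(1)]] by simp
  have kin: "d_conserved U h \<bullet> stack (\<chi> i. d_potential i (thermo U) (thermo h) - velo U \<bullet> velo h) (velo h) 0
      = (\<Sum>i\<in>UNIV. dens h $ i * d_potential i (thermo U) (thermo h)) + mass U * (velo h \<bullet> velo h)"
    by (simp add: d_conserved_def inner_state inner_vec_def[of "dens h"] inner_add_left mass_def total_mass_def
        sum_subtractf sum_distrib_right algebra_simps)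
  have eq: "temp U * (d_conserved U h \<bullet> G' h) = ?c + mass U * (velo h \<bullet> velo h)"
    using t by (simp add: G'_eq inner_diff_right kin inner_commute[of _ "G_map \<mu> U"]
        entropy_compatible[OF assms(1)] field_simps)
  have "0 < ?c + mass U * (velo h \<bullet> velo h)"
  proof (cases "thermo h = 0")
    case True
    then have "dens h = 0" "temp h = 0" by (simp_all add: thermo_def prod_eq_iff)
    then have "velo h \<noteq> 0" using \<open>h \<noteq> 0\<close>
      using state_eqI[of h 0] by auto
    then show ?thesis using m \<open>dens h = 0\<close> \<open>temp h = 0\<close> by simp
  next
    case False
    from thermodynamic_stability[OF thermo_in_domain[OF assms(1)] assms(2) pd False]
    show ?thesis using m by (simp add: add_pos_nonneg)
  qed
  then show ?thesis using t unfolding eq[symmetric] by (simp add: zero_less_mult_iff)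
qed

text \<open>Positivity of the heat capacity makes the temperature recoverable from the densities and the
  internal energy, which is the nontrivial step in the injectivity of \<open>A_map\<close>.\<close>

lemma energy_strict_mono:
  assumes e: "\<And>w. w \<in> thermo_domain \<Longrightarrow> 0 < pd_theta e w"
    and "(r, s) \<in> thermo_domain" "s < t"
  shows "energy (r, s) < energy (r, t)"
proof (rule DERIV_pos_imp_increasing[OF assms(3)])
  fix \<theta> assume \<theta>: "s \<le> \<theta>" "\<theta> \<le> t"
  then have w: "(r, \<theta>) \<in> thermo_domain" using assms(2) by (auto simp: thermo_domain_def)
  let ?d = "\<theta> * d_entropy (r, \<theta>) (0, 1)"
  have "((\<lambda>\<theta>. (r, \<theta>)) has_derivative (\<lambda>c. (0, c))) (at \<theta>)"
    by (auto intro!: derivative_eq_intros)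
  from has_derivative_compose[OF this energy_has_derivative[OF w]]
  have der: "((\<lambda>\<theta>. energy (r, \<theta>)) has_derivative (\<lambda>c. \<theta> * d_entropy (r, \<theta>) (0, c))) (at \<theta>)"
    by simp
  have lin: "d_entropy (r, \<theta>) (0, c) = c * d_entropy (r, \<theta>) (0, 1)" for c
    using thermo_linear_decomp[OF has_derivative_linear[OF C2_has_derivative[OF Ck_entropy w]], of "(0, c)"] by simp
  have "(\<lambda>c. \<theta> * d_entropy (r, \<theta>) (0, c)) = (*) ?d"
    by (rule ext) (subst lin, simp)
  with der have "((\<lambda>\<theta>. energy (r, \<theta>)) has_real_derivative ?d) (at \<theta>)"
    by (simp add: has_field_derivative_def)
  moreover have "0 < ?d"
    using heat_capacity[OF w] e[OF w] total_mass_pos[OF w] by simp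
  ultimately show "\<exists>y. ((\<lambda>\<theta>. energy (r, \<theta>)) has_real_derivative y) (at \<theta>) \<and> 0 < y" by blast
qed

lemma conserved_inj:
  assumes e: "\<And>w. w \<in> thermo_domain \<Longrightarrow> 0 < pd_theta e w"
  shows "inj_on (A_map e) (state_domain :: (real^('n + 3 + 1)) set)"
proof (rule inj_onI)
  fix U V :: "real^('n + 3 + 1)"
  assume dom: "U \<in> state_domain" "V \<in> state_domain" and eq: "A_map e U = A_map e V"
  have d: "dens U = dens V" using arg_cong[OF eq, of dens] by (simp add: A_map_def)
  then have m: "mass U = mass V" by (simp add: mass_def)
  have v: "velo U = velo V"
    using arg_cong[OF eq, of velo] mass_pos[OF dom(1)] by (simp add: A_map_def m)
  have "energy (dens V, temp U) = energy (dens V, temp V)"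
    using arg_cong[OF eq, of temp] by (simp add: A_map_def total_energy_eq m v thermo_def d)
  moreover have "(dens V, temp U) \<in> thermo_domain" "(dens V, temp V) \<in> thermo_domain"
    using thermo_in_domain[OF dom(1)] thermo_in_domain[OF dom(2)] by (simp_all add: thermo_def d)
  ultimately have "temp U = temp V"
    using energy_strict_mono[OF e] by (metis less_irrefl linorder_neqE_linordered_idom)
  with d v show "U = V" by (rule state_eqI)
qed

lemma conserved_jacobian_invertible:
  assumes "U \<in> state_domain" "0 < pd_theta e (thermo U)"
  shows "invertible (jacobian (A_map e) (at U))"
proof -
  have lin: "linear (d_conserved U)"
    using conserved_has_derivative[OF assms(1)] by (rule has_derivative_linear)
  have "h = 0" if "d_conserved U h = 0" for h
  proof (rule state_eqI)
    have d: "dens h = 0"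
      using arg_cong[OF that, of dens] by (simp add: d_conserved_def)
    then have mh: "mass h = 0" by (simp add: mass_def total_mass_def)
    have v: "velo h = 0"
      using arg_cong[OF that, of velo] mass_pos[OF assms(1)] by (simp add: d_conserved_def mh)
    have "temp U * d_entropy (thermo U) (thermo h) = 0"
      using arg_cong[OF that, of temp] by (simp add: d_conserved_def mh v d)
    moreover have "d_entropy (thermo U) (thermo h) = temp h * d_entropy (thermo U) (0, 1)"
      using thermo_linear_decomp[OF has_derivative_linear[OF C2_has_derivative[OF Ck_entropy thermo_in_domain[OF assms(1)]]], of "thermo h"]
      by (simp add: d)
    ultimately have "temp h * (mass U * pd_theta e (thermo U)) = 0"
      using heat_capacity[OF thermo_in_domain[OF assms(1)]] by (auto simp: mass_def)
    then have "temp h = 0" using mass_pos[OF assms(1)] assms(2) by simp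
    then show "dens h = dens 0" "velo h = velo 0" "temp h = temp 0" using d v by simp_all
  qed
  then have "inj (d_conserved U)" using linear_injective_0[OF lin] by blast
  then show ?thesis
    using lin by (simp add: jacobian_eq_matrix[OF conserved_has_derivative[OF assms(1)]] invertible_left_inverse
        matrix_left_invertible_injective matrix_works)
qed

end

section \<open>Fields on space-time\<close>

lemma d_time_eq: "(f has_derivative f') (at z) \<Longrightarrow> d_time f z = f' (1, 0)"
  and d_space_eq: "(f has_derivative f') (at z) \<Longrightarrow> d_space k f z = f' (0, axis k 1)"
  by (simp_all add: d_time_def d_space_def flip: frechet_derivative_at)

lemma d_time_linear:
  "bounded_linear L \<Longrightarrow> (f has_derivative f') (at z) \<Longrightarrow> d_time (\<lambda>y. L (f y)) z = L (d_time f z)"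
  and d_space_linear:
  "bounded_linear L \<Longrightarrow> (f has_derivative f') (at z) \<Longrightarrow> d_space k (\<lambda>y. L (f y)) z = L (d_space k f z)"
  using d_time_eq[OF bounded_linear.has_derivative[of L f f' "at z"]] d_time_eq[of f f' z]
    d_space_eq[OF bounded_linear.has_derivative[of L f f' "at z"]] d_space_eq[of f f' z]
  by simp_all

lemma divergence_eq:
  assumes "(V has_derivative V') (at z)"
  shows "divergence V z = (\<Sum>k\<in>UNIV. V' (0, axis k 1) $ k)"
  using d_space_eq[OF bounded_linear.has_derivative[OF bounded_linear_vec_nth assms]]
  by (simp add: divergence_def)

lemma divergence_uminus: "V differentiable (at z) \<Longrightarrow> divergence (\<lambda>y. - V y) z = - divergence V z"
  unfolding frechet_derivative_works
  by (simp add: divergence_eq[OF has_derivative_minus] divergence_eq sum_negf)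

lemma divergence_diff:
  "V differentiable (at z) \<Longrightarrow> W differentiable (at z) \<Longrightarrow>
    divergence (\<lambda>y. V y - W y) z = divergence V z - divergence W z"
  unfolding frechet_derivative_works
  by (simp add: divergence_eq[OF has_derivative_diff] divergence_eq sum_subtractf)

lemma divergence_sum:
  assumes "\<And>i. i \<in> I \<Longrightarrow> V i differentiable (at z)"
  shows "divergence (\<lambda>y. \<Sum>i\<in>I. V i y) z = (\<Sum>i\<in>I. divergence (V i) z)"
proof -
  have V: "(V i has_derivative frechet_derivative (V i) (at z)) (at z)" if "i \<in> I" for i
    using assms[OF that] by (simp add: frechet_derivative_works)
  have "divergence (\<lambda>y. \<Sum>i\<in>I. V i y) z
      = (\<Sum>k\<in>UNIV. \<Sum>i\<in>I. frechet_derivative (V i) (at z) (0, axis k 1) $ k)"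
    using divergence_eq[OF has_derivative_sum[OF V, of I]] by simp
  also have "\<dots> = (\<Sum>i\<in>I. \<Sum>k\<in>UNIV. frechet_derivative (V i) (at z) (0, axis k 1) $ k)"
    by (rule sum.swap)
  also have "\<dots> = (\<Sum>i\<in>I. divergence (V i) z)"
    by (intro sum.cong refl divergence_eq[symmetric] V)
  finally show ?thesis .
qed

lemma divergence_scaleR:
  assumes "g differentiable (at z)" "V differentiable (at z)"
  shows "divergence (\<lambda>y. g y *\<^sub>R V y) z = g z * divergence V z + space_grad g z \<bullet> V z"
proof -
  have g: "(g has_derivative frechet_derivative g (at z)) (at z)"
    and V: "(V has_derivative frechet_derivative V (at z)) (at z)"
    using assms by (simp_all add: frechet_derivative_works)
  show ?thesis
    unfolding divergence_eq[OF has_derivative_scaleR[OF g V]] divergence_eq[OF V]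
    by (simp add: space_grad_def d_space_def inner_vec_def sum.distrib sum_distrib_left)
qed

lemma divergence_cong_open:
  assumes "open W" "z \<in> W" "\<And>y. y \<in> W \<Longrightarrow> V y = V' y" "V differentiable (at z)"
  shows "divergence V' z = divergence V z"
proof -
  have V: "(V has_derivative frechet_derivative V (at z)) (at z)"
    using assms(4) by (simp add: frechet_derivative_works)
  show ?thesis
    unfolding divergence_eq[OF V]
    by (rule divergence_eq[OF has_derivative_transform_within_open[OF V assms(1-3)]])
qed

lemma space_grad_inverse:
  assumes "g differentiable (at z)" "g z \<noteq> 0"
  shows "space_grad (\<lambda>y. 1 / g y) z = - (1 / (g z)\<^sup>2) *\<^sub>R space_grad g z"
proof -
  have g: "(g has_derivative frechet_derivative g (at z)) (at z)"
    using assms by (simp add: frechet_derivative_works)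
  have "((\<lambda>y. 1 / g y) has_derivative (\<lambda>h. - (frechet_derivative g (at z) h / (g z)\<^sup>2))) (at z)"
    using assms(2) by (auto intro!: derivative_eq_intros g simp: fun_eq_iff power2_eq_square)
  then show ?thesis
    unfolding space_grad_def d_space_eq[OF g] by (simp add: vec_eq_iff d_space_eq)
qed

text \<open>Averaging the double sum with its copy under \<open>i \<leftrightarrow> j\<close> turns \<open>u\<^sub>i \<bullet> (u\<^sub>i - u\<^sub>j)\<close> into \<open>|u\<^sub>i - u\<^sub>j|\<^sup>2 / 2\<close>, by
  the symmetry of the coefficients.\<close>

lemma friction_dissipation:
  fixes B :: "'n::finite \<Rightarrow> 'n \<Rightarrow> real" and u :: "'n \<Rightarrow> 'a::real_inner"
  assumes "\<And>i j. B i j = B j i" "\<And>i j. 0 \<le> B i j"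
  shows "0 \<le> (\<Sum>i\<in>UNIV. u i \<bullet> (\<Sum>j\<in>UNIV - {i}. B i j *\<^sub>R (u i - u j)))"
proof -
  let ?S = "\<Sum>i\<in>UNIV. \<Sum>j\<in>UNIV. B i j * (u i \<bullet> (u i - u j))"
  have "?S = (\<Sum>i\<in>UNIV. \<Sum>j\<in>UNIV. B j i * (u j \<bullet> (u j - u i)))"
    by (rule sum.swap)
  then have "2 * ?S = (\<Sum>i\<in>UNIV. \<Sum>j\<in>UNIV. B i j * (u i \<bullet> (u i - u j)) + B j i * (u j \<bullet> (u j - u i)))"
    by (simp add: sum.distrib)
  also have "\<dots> = (\<Sum>i\<in>UNIV. \<Sum>j\<in>UNIV. B i j * ((u i - u j) \<bullet> (u i - u j)))"
    by (intro sum.cong refl) (subst assms(1), simp add: algebra_simps inner_commute)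
  also have "\<dots> \<ge> 0" using assms(2) by (intro sum_nonneg mult_nonneg_nonneg) auto
  finally have "0 \<le> ?S" by simp
  also have "?S = (\<Sum>i\<in>UNIV. u i \<bullet> (\<Sum>j\<in>UNIV - {i}. B i j *\<^sub>R (u i - u j)))"
    by (intro sum.cong refl) (simp add: inner_sum_right sum_diff1)
  finally show ?thesis .
qed

section \<open>Entropy balance\<close>

text \<open>In this form the entropy production consists of exactly the terms that the product rule produces when
  \<open>1 / \<theta>\<close> and \<open>\<mu>\<^sub>i / \<theta>\<close> are moved inside the divergences. The pressure gradient in the forces
  disappears because it is multiplied by \<open>\<Sum>\<^sub>i \<rho>\<^sub>i u\<^sub>i = 0\<close>.\<close>

lemma entropy_production_eq:
  assumes "(\<Sum>i\<in>UNIV. dens (U z) $ i *\<^sub>R u i z) = 0"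
    and "(\<lambda>y. temp (U y)) differentiable (at z)" "0 < temp (U z)"
  shows "entropy_production \<mu> p e_part p_part \<kappa> U u z =
     - (heat_flux e_part p_part \<kappa> U u z \<bullet> space_grad (\<lambda>y. 1 / temp (U y)) z)
     - (\<Sum>i\<in>UNIV. space_grad (\<lambda>y. \<mu> i (thermo (U y)) / temp (U y)) z \<bullet> (dens (U z) $ i *\<^sub>R u i z))"
proof -
  let ?\<theta> = "temp (U z)" and ?r = "dens (U z)" and ?\<kappa> = "\<kappa> (thermo (U z))"
  define g where "g = space_grad (\<lambda>y. temp (U y)) z"
  define P where "P = space_grad (\<lambda>y. p (thermo (U y))) z"
  define Z where "Z = space_grad (\<lambda>y. 1 / temp (U y)) z"
  define M where "M i = space_grad (\<lambda>y. \<mu> i (thermo (U y)) / temp (U y)) z" for i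
  define c where "c i = ?r $ i * e_part i (thermo (U z)) + p_part i (thermo (U z))" for i
  have Z: "Z = - (1 / ?\<theta>\<^sup>2) *\<^sub>R g"
    unfolding Z_def g_def by (rule space_grad_inverse) (use assms in auto)
  have "(\<Sum>i\<in>UNIV. u i z \<bullet> diffusive_force \<mu> p e_part p_part U i z)
      = (\<Sum>i\<in>UNIV. - (1 / mass (U z)) * ((?r $ i *\<^sub>R u i z) \<bullet> P) + ?\<theta> * (M i \<bullet> (?r $ i *\<^sub>R u i z)) - ?\<theta> * ((c i *\<^sub>R u i z) \<bullet> Z))"
    by (intro sum.cong refl)
      (simp add: diffusive_force_def Let_def P_def Z_def M_def c_def inner_commute algebra_simps)
  also have "\<dots> = - (1 / mass (U z)) * ((\<Sum>i\<in>UNIV. ?r $ i *\<^sub>R u i z) \<bullet> P)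
      + ?\<theta> * (\<Sum>i\<in>UNIV. M i \<bullet> (?r $ i *\<^sub>R u i z)) - ?\<theta> * ((\<Sum>i\<in>UNIV. c i *\<^sub>R u i z) \<bullet> Z)"
    by (simp only: sum.distrib sum_subtractf inner_sum_left sum_distrib_left)
  finally have force: "(\<Sum>i\<in>UNIV. u i z \<bullet> diffusive_force \<mu> p e_part p_part U i z)
      = ?\<theta> * (\<Sum>i\<in>UNIV. M i \<bullet> (?r $ i *\<^sub>R u i z)) - ?\<theta> * ((\<Sum>i\<in>UNIV. c i *\<^sub>R u i z) \<bullet> Z)"
    unfolding assms(1) by simp
  have flux: "heat_flux e_part p_part \<kappa> U u z \<bullet> Z
      = - (1 / ?\<theta>\<^sup>2 * ?\<kappa> * (norm g)\<^sup>2) - (\<Sum>i\<in>UNIV. c i *\<^sub>R u i z) \<bullet> Z"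
    by (simp add: heat_flux_def c_def[symmetric] g_def[symmetric] inner_diff_left)
      (simp add: Z power2_norm_eq_inner)
  show ?thesis
    unfolding entropy_production_def force Z_def[symmetric] M_def[symmetric] flux g_def[symmetric]
    using assms(3) by (simp add: right_diff_distrib)
qed

text \<open>The force balance replaces the forces by friction between the components, whose power is
  non-negative.\<close>

lemma entropy_production_nonneg:
  assumes sol: "smooth_solution e \<mu> p e_part p_part \<kappa> b \<epsilon> W U u" and "z \<in> W" "0 < \<epsilon>"
    and \<kappa>: "\<forall>w\<in>thermo_domain. 0 \<le> \<kappa> w"
    and b_sym: "\<forall>(r, \<theta>)\<in>thermo_domain. \<forall>i j. b i j (r $ i) (r $ j) \<theta> = b j i (r $ j) (r $ i) \<theta>"
    and b_pos: "\<forall>(r, \<theta>)\<in>thermo_domain. \<forall>i j. 0 < b i j (r $ i) (r $ j) \<theta>"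
  shows "0 \<le> entropy_production \<mu> p e_part p_part \<kappa> U u z"
proof -
  let ?\<theta> = "temp (U z)" and ?r = "dens (U z)"
  let ?B = "\<lambda>i j. b i j (?r $ i) (?r $ j) ?\<theta> * ?\<theta> * ?r $ i * ?r $ j"
  have dom: "U z \<in> state_domain" and force: "\<And>i. \<epsilon> *\<^sub>R diffusive_force \<mu> p e_part p_part U i z
      = - (\<Sum>j\<in>UNIV - {i}. ?B i j *\<^sub>R (u i z - u j z))"
    using sol \<open>z \<in> W\<close> by (auto simp: smooth_solution_def)
  have w: "(?r, ?\<theta>) \<in> thermo_domain" using dom by (simp add: state_domain_vimage thermo_def)
  then have pos: "0 < ?\<theta>" "\<And>i. 0 < ?r $ i" by (auto simp: thermo_domain_def)
  have sym: "?B i j = ?B j i" for i j using b_sym w by auto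
  have nonneg: "0 \<le> ?B i j" for i j
  proof -
    have "0 < b i j (?r $ i) (?r $ j) ?\<theta>" using b_pos w by auto
    then show ?thesis using pos by (simp add: less_imp_le)
  qed
  have "0 \<le> (\<Sum>i\<in>UNIV. u i z \<bullet> (\<Sum>j\<in>UNIV - {i}. ?B i j *\<^sub>R (u i z - u j z)))"
    by (rule friction_dissipation[of ?B "\<lambda>i. u i z", OF sym nonneg])
  also have "\<dots> = - \<epsilon> * (\<Sum>i\<in>UNIV. u i z \<bullet> diffusive_force \<mu> p e_part p_part U i z)"
    unfolding sum_distrib_left
  proof (rule sum.cong[OF refl])
    fix i
    show "u i z \<bullet> (\<Sum>j\<in>UNIV - {i}. ?B i j *\<^sub>R (u i z - u j z))
        = - \<epsilon> * (u i z \<bullet> diffusive_force \<mu> p e_part p_part U i z)"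
      using arg_cong[OF force[of i], of "\<lambda>x. u i z \<bullet> x"] by simp
  qed
  finally have "(\<Sum>i\<in>UNIV. u i z \<bullet> diffusive_force \<mu> p e_part p_part U i z) \<le> 0"
    using \<open>0 < \<epsilon>\<close> by (simp add: mult_le_0_iff)
  then have "1 / ?\<theta> * (\<Sum>i\<in>UNIV. u i z \<bullet> diffusive_force \<mu> p e_part p_part U i z) \<le> 0"
    using pos(1) by (intro mult_nonneg_nonpos) auto
  moreover have "0 \<le> \<kappa> (thermo (U z))" using \<kappa> dom by (simp add: state_domain_vimage)
  then have "0 \<le> 1 / ?\<theta>\<^sup>2 * \<kappa> (thermo (U z)) * (norm (space_grad (\<lambda>y. temp (U y)) z))\<^sup>2"
    by simp
  ultimately show ?thesis unfolding entropy_production_def by linarith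
qed

context gibbs_relations
begin

text \<open>Chain rule and compatibility: testing the transport part of the system with the entropy variable
  gives the transport part of the entropy equation.\<close>

lemma entropy_transport:
  assumes "(U has_derivative U') (at z)" "U z \<in> state_domain"
  shows "d_time (\<lambda>y. H_fun \<eta> (U y)) z + (\<Sum>k\<in>UNIV. d_space k (\<lambda>y. Q_fun \<eta> k (U y)) z)
    = G_map \<mu> (U z) \<bullet> (d_time (\<lambda>y. A_map e (U y)) z + (\<Sum>k\<in>UNIV. d_space k (\<lambda>y. F_map e p k (U y)) z))"
  unfolding d_time_eq[OF has_derivative_compose[OF assms(1) entropy_has_derivative[OF assms(2)]]]
    d_time_eq[OF has_derivative_compose[OF assms(1) conserved_has_derivative[OF assms(2)]]]
    d_space_eq[OF has_derivative_compose[OF assms(1) entropy_flux_has_derivative[OF assms(2)]]]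
    d_space_eq[OF has_derivative_compose[OF assms(1) flux_has_derivative[OF assms(2)]]]
  by (simp only: inner_add_right inner_sum_right entropy_compatible[OF assms(2)] entropy_flux_compatible[OF assms(2)])

text \<open>Matches the operators of the system, written for vector and tensor fields, with the derivatives of
  \<open>A_map\<close> and \<open>F_map\<close> along the solution.\<close>

lemma conservation_components:
  assumes "(U has_derivative U') (at z)" "U z \<in> state_domain"
  shows "d_time (\<lambda>y. A_map e (U y)) z + (\<Sum>k\<in>UNIV. d_space k (\<lambda>y. F_map e p k (U y)) z)
    = stack (\<chi> i. d_time (\<lambda>y. dens (U y) $ i) z + divergence (\<lambda>y. dens (U y) $ i *\<^sub>R velo (U y)) z)
       (d_time (\<lambda>y. mass (U y) *\<^sub>R velo (U y)) z
          + tensor_divergence (\<lambda>y. mass (U y) *\<^sub>R outer (velo (U y)) (velo (U y))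
                                  + p (thermo (U y)) *\<^sub>R mat 1) z)
       (d_time (\<lambda>y. total_energy e (U y)) z
          + divergence (\<lambda>y. total_energy e (U y) *\<^sub>R velo (U y) + p (thermo (U y)) *\<^sub>R velo (U y)) z)"
    (is "?L = ?R")
proof -
  note A' = has_derivative_compose[OF assms(1) conserved_has_derivative[OF assms(2)]]
  note F' = has_derivative_compose[OF assms(1) flux_has_derivative[OF assms(2)]]
  have lin: "L ?L = d_time (\<lambda>y. L (A_map e (U y))) z + (\<Sum>k\<in>UNIV. d_space k (\<lambda>y. L (F_map e p k (U y))) z)"
    if L: "bounded_linear L" for L :: "real^('n + 3 + 1) \<Rightarrow> 'b::real_normed_vector"
    unfolding d_time_linear[OF L A'] d_space_linear[OF L F']
    by (simp add: linear_simps[OF L] linear_sum[OF bounded_linear.linear[OF L]])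
  have T: "(mass (U y) *\<^sub>R outer (velo (U y)) (velo (U y)) + p (thermo (U y)) *\<^sub>R mat 1) $ j $ k
      = mass (U y) * velo (U y) $ j * velo (U y) $ k + p (thermo (U y)) * (if j = k then 1 else 0)" for y j k
    by (simp add: outer_def mat_def)
  show ?thesis
  proof (rule state_eqI)
    have "dens ?L $ i = dens ?R $ i" for i
      using lin[OF bounded_linear_compose[OF bounded_linear_vec_nth bounded_linear_dens], of i]
      by (simp add: A_map_def F_map_def divergence_def)
    then show "dens ?L = dens ?R" by (simp add: vec_eq_iff)
    have "velo ?L $ j = velo ?R $ j" for j
    proof -
      have "d_time (\<lambda>y. velo (A_map e (U y)) $ j) z = d_time (\<lambda>y. velo (A_map e (U y))) z $ j"
        by (rule d_time_linear[OF bounded_linear_vec_nth bounded_linear.has_derivative[OF bounded_linear_velo A']])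
      then show ?thesis
        using lin[OF bounded_linear_compose[OF bounded_linear_vec_nth bounded_linear_velo], of j]
        by (simp add: tensor_divergence_def divergence_def T[simplified] A_map_def F_map_def)
    qed
    then show "velo ?L = velo ?R" by (simp add: vec_eq_iff)
    show "temp ?L = temp ?R"
      using lin[OF bounded_linear_temp]
      by (simp add: A_map_def F_map_def divergence_def distrib_right)
  qed
qed

text \<open>Testing the system with \<open>G\<close> leaves \<open>- \<Sum>\<^sub>i (\<mu>\<^sub>i / \<theta>) div (\<rho>\<^sub>i u\<^sub>i) - (1 / \<theta>) div q\<close>, with \<open>q\<close> the heat flux; the
  kinetic part of \<open>G\<close> is the same in all density components and meets \<open>\<Sum>\<^sub>i div (\<rho>\<^sub>i u\<^sub>i) = 0\<close>. The entropy flux on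
  the right is \<open>- q / \<theta> - \<Sum>\<^sub>i (\<mu>\<^sub>i / \<theta>) \<rho>\<^sub>i u\<^sub>i\<close>, and the product rule supplies the difference. Only the
  combination \<open>q\<close> is differentiated, since its summands need not be differentiable separately.\<close>

lemma entropy_balance:
  assumes "open W" "z \<in> W" and sol: "smooth_solution e \<mu> p e_part p_part \<kappa> b \<epsilon> W U u"
  shows "d_time (\<lambda>y. - (mass (U y) * \<eta> (thermo (U y)))) z
             + divergence (\<lambda>y. - (mass (U y) * \<eta> (thermo (U y))) *\<^sub>R velo (U y)) z
           = divergence (\<lambda>y.
                 (1 / temp (U y)) *\<^sub>R (\<Sum>i\<in>UNIV.
                    (dens (U y) $ i * e_part i (thermo (U y)) + p_part i (thermo (U y))
                       - dens (U y) $ i * \<mu> i (thermo (U y))) *\<^sub>R u i y)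
                 - (1 / temp (U y) * \<kappa> (thermo (U y))) *\<^sub>R space_grad (\<lambda>x. temp (U x)) y) z
             - entropy_production \<mu> p e_part p_part \<kappa> U u z"
proof -
  let ?HF = "heat_flux e_part p_part \<kappa> U u" and ?\<theta> = "temp (U z)"
  let ?J = "\<lambda>i y. dens (U y) $ i *\<^sub>R u i y"
  let ?m = "\<lambda>i y. \<mu> i (thermo (U y)) / temp (U y)"
  have dom: "U y \<in> state_domain" and closure: "(\<Sum>i\<in>UNIV. ?J i y) = 0" if "y \<in> W" for y
    using sol that by (auto simp: smooth_solution_def)
  have t: "0 < ?\<theta>" by (rule temp_pos[OF dom[OF assms(2)]])
  have U: "U differentiable (at z)" and u: "u i differentiable (at z)" and HF: "?HF differentiable (at z)" for i
    using sol assms(2) by (auto simp: smooth_solution_def)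
  have U': "(U has_derivative frechet_derivative U (at z)) (at z)"
    using U by (simp add: frechet_derivative_works)
  have dens': "(\<lambda>y. dens (U y) $ i) differentiable (at z)" for i
    by (rule differentiableI[OF bounded_linear.has_derivative[OF bounded_linear_compose[OF bounded_linear_vec_nth bounded_linear_dens] U']])
  have temp': "(\<lambda>y. temp (U y)) differentiable (at z)"
    by (rule differentiableI[OF bounded_linear.has_derivative[OF bounded_linear_temp U']])
  have J: "?J i differentiable (at z)" for i
    by (rule differentiable_scaleR[OF dens' u])
  have inv: "(\<lambda>y. 1 / temp (U y)) differentiable (at z)"
    using temp' t by (intro differentiable_divide) auto
  have "(\<lambda>y. \<mu> i (thermo (U y))) differentiable (at z)" for i
    by (rule differentiableI[OF has_derivative_compose[OF U' C2_thermo_has_derivative[OF Ck_potential dom[OF assms(2)]]]])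
  then have m: "?m i differentiable (at z)" for i
    using temp' t by (intro differentiable_divide) auto
  have mass_flux: "(\<Sum>i\<in>UNIV. divergence (?J i) z) = 0"
  proof -
    have "(\<Sum>i\<in>UNIV. divergence (?J i) z) = divergence (\<lambda>y. \<Sum>i\<in>UNIV. ?J i y) z"
      by (rule divergence_sum[symmetric]) (rule J)
    also have "\<dots> = divergence (\<lambda>y. 0) z"
      by (rule divergence_cong_open[OF assms(1,2)]) (simp_all add: closure)
    also have "\<dots> = 0" by (simp add: divergence_eq[OF has_derivative_const])
    finally show ?thesis .
  qed
  have "d_time (\<lambda>y. - (mass (U y) * \<eta> (thermo (U y)))) z
      + divergence (\<lambda>y. - (mass (U y) * \<eta> (thermo (U y))) *\<^sub>R velo (U y)) z
    = d_time (\<lambda>y. H_fun \<eta> (U y)) z + (\<Sum>k\<in>UNIV. d_space k (\<lambda>y. Q_fun \<eta> k (U y)) z)"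
    by (simp add: H_fun_def Q_fun_def divergence_def)
  also have "\<dots> = G_map \<mu> (U z) \<bullet> stack (\<chi> i. - divergence (?J i) z) 0 (divergence ?HF z)"
    unfolding entropy_transport[OF U' dom[OF assms(2)]] conservation_components[OF U' dom[OF assms(2)]]
    using sol assms(2) by (simp add: smooth_solution_def)
  also have "\<dots> = - (\<Sum>i\<in>UNIV. ?m i z * divergence (?J i) z) - (1 / ?\<theta>) * divergence ?HF z"
  proof -
    have "total_mass (\<chi> i. - divergence (?J i) z) = 0"
      using mass_flux by (simp add: total_mass_def sum_negf)
    then have "?\<theta> * (G_map \<mu> (U z) \<bullet> stack (\<chi> i. - divergence (?J i) z) 0 (divergence ?HF z))
        = - (\<Sum>i\<in>UNIV. divergence (?J i) z * \<mu> i (thermo (U z))) - divergence ?HF z"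
      using t by (subst inner_entropy_variable) (simp_all add: sum_negf)
    also have "\<dots> = ?\<theta> * (- (\<Sum>i\<in>UNIV. ?m i z * divergence (?J i) z) - (1 / ?\<theta>) * divergence ?HF z)"
    proof -
      have "(\<Sum>i\<in>UNIV. divergence (?J i) z * \<mu> i (thermo (U z))) = ?\<theta> * (\<Sum>i\<in>UNIV. ?m i z * divergence (?J i) z)"
        unfolding sum_distrib_left using t by (intro sum.cong refl) simp
      then show ?thesis using t by (simp add: right_diff_distrib)
    qed
    finally show ?thesis
      by (rule mult_left_cancel[THEN iffD1, OF less_imp_neq[OF t, symmetric]])
  qed
  finally have lhs: "d_time (\<lambda>y. - (mass (U y) * \<eta> (thermo (U y)))) z
      + divergence (\<lambda>y. - (mass (U y) * \<eta> (thermo (U y))) *\<^sub>R velo (U y)) z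
    = - (\<Sum>i\<in>UNIV. ?m i z * divergence (?J i) z) - (1 / ?\<theta>) * divergence ?HF z" .
  \<comment> \<open>The entropy flux regrouped so that every factor is differentiable.\<close>
  have flux: "(\<lambda>y. (1 / temp (U y)) *\<^sub>R (\<Sum>i\<in>UNIV.
                    (dens (U y) $ i * e_part i (thermo (U y)) + p_part i (thermo (U y))
                       - dens (U y) $ i * \<mu> i (thermo (U y))) *\<^sub>R u i y)
                 - (1 / temp (U y) * \<kappa> (thermo (U y))) *\<^sub>R space_grad (\<lambda>x. temp (U x)) y)
      = (\<lambda>y. - ((1 / temp (U y)) *\<^sub>R ?HF y) - (\<Sum>i\<in>UNIV. ?m i y *\<^sub>R ?J i y))"
    by (rule ext) (simp add: heat_flux_def scaleR_sum_right scaleR_diff_left scaleR_diff_right sum_subtractf mult.commute)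
  have rhs: "divergence (\<lambda>y. - ((1 / temp (U y)) *\<^sub>R ?HF y) - (\<Sum>i\<in>UNIV. ?m i y *\<^sub>R ?J i y)) z
      = - (1 / ?\<theta> * divergence ?HF z + space_grad (\<lambda>y. 1 / temp (U y)) z \<bullet> ?HF z)
        - (\<Sum>i\<in>UNIV. ?m i z * divergence (?J i) z + space_grad (?m i) z \<bullet> ?J i z)"
  proof -
    have 1: "(\<lambda>y. (1 / temp (U y)) *\<^sub>R ?HF y) differentiable (at z)"
      by (rule differentiable_scaleR[OF inv HF])
    have 2: "(\<lambda>y. ?m i y *\<^sub>R ?J i y) differentiable (at z)" for i
      by (rule differentiable_scaleR[OF m J])
    have 3: "(\<lambda>y. \<Sum>i\<in>UNIV. ?m i y *\<^sub>R ?J i y) differentiable (at z)"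
      by (rule differentiable_sum) (simp_all only: finite 2 simp_thms ball_simps)
    show ?thesis
      unfolding divergence_diff[OF differentiable_minus[OF 1] 3] divergence_uminus[OF 1]
        divergence_sum[OF 2] divergence_scaleR[OF inv HF] divergence_scaleR[OF m J] ..
  qed
  show ?thesis
    unfolding lhs flux rhs entropy_production_eq[where p = p and U = U and u = u and z = z, OF closure[OF assms(2)] temp' t]
    by (simp add: sum.distrib inner_commute[of "space_grad (\<lambda>y. 1 / temp (U y)) z"])
qed

end

section \<open>The hyperbolic-parabolic structure\<close>

theorem mainTheorem4:
  fixes \<psi> \<eta> e p \<kappa> :: "(real^'n::finite) \<times> real \<Rightarrow> real"
    and \<mu> e_part p_part :: "'n \<Rightarrow> (real^'n) \<times> real \<Rightarrow> real"
    and b :: "'n \<Rightarrow> 'n \<Rightarrow> real \<Rightarrow> real \<Rightarrow> real \<Rightarrow> real"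
    and \<epsilon> :: real
  assumes "Ck_on 3 thermo_domain \<psi>"
    and "thermodynamic_relations \<psi> \<eta> e \<mu> p"
    and "partial_relations e p e_part p_part"
    and "\<forall>w\<in>thermo_domain. 0 < pd_theta e w"
    and "\<forall>w\<in>thermo_domain.
           positive_definite (\<chi> i j. pd_rho j (pd_rho i (free_energy \<psi>)) w)"
    and "\<forall>w\<in>thermo_domain. 0 \<le> \<kappa> w"
    and "\<forall>(r, \<theta>)\<in>thermo_domain. \<forall>i j. b i j (r $ i) (r $ j) \<theta> = b j i (r $ j) (r $ i) \<theta>"
    and "\<forall>(r, \<theta>)\<in>thermo_domain. \<forall>i j. 0 < b i j (r $ i) (r $ j) \<theta>"
    and "0 < \<epsilon>"
  shows
    "(Ck_on 2 state_domain (A_map e)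
      \<and> bij_betw (A_map e) state_domain (A_map e ` state_domain)
      \<and> (\<forall>U\<in>state_domain. invertible (jacobian (A_map e) (at U))))
   \<and> (\<forall>U\<in>state_domain.
        gradient (H_fun \<eta>) U = G_map \<mu> U v* jacobian (A_map e) (at U)
        \<and> (\<forall>\<alpha>. gradient (Q_fun \<eta> \<alpha>) U = G_map \<mu> U v* jacobian (F_map e p \<alpha>) (at U)))
   \<and> (\<forall>U\<in>state_domain.
        let M = hessian (H_fun \<eta>) U
                - (\<Sum>j\<in>UNIV. G_map \<mu> U $ j *\<^sub>R hessian (\<lambda>V. A_map e V $ j) U)
        in symmetric_matrix M \<and> positive_definite M)
   \<and> (\<forall>W U u. open W \<and> smooth_solution e \<mu> p e_part p_part \<kappa> b \<epsilon> W U u \<longrightarrow>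
        (\<forall>z\<in>W.
           d_time (\<lambda>y. - (mass (U y) * \<eta> (thermo (U y)))) z
             + divergence (\<lambda>y. - (mass (U y) * \<eta> (thermo (U y))) *\<^sub>R velo (U y)) z
           = divergence (\<lambda>y.
                 (1 / temp (U y)) *\<^sub>R (\<Sum>i\<in>UNIV.
                    (dens (U y) $ i * e_part i (thermo (U y)) + p_part i (thermo (U y))
                       - dens (U y) $ i * \<mu> i (thermo (U y))) *\<^sub>R u i y)
                 - (1 / temp (U y) * \<kappa> (thermo (U y))) *\<^sub>R space_grad (\<lambda>x. temp (U x)) y) z
             - entropy_production \<mu> p e_part p_part \<kappa> U u z
           \<and> 0 \<le> entropy_production \<mu> p e_part p_part \<kappa> U u z))"
    (is "?conserved \<and> ?compatible \<and> ?convex \<and> ?balance")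
proof -
  interpret gibbs_relations \<psi> \<eta> e p \<mu>
    by unfold_locales (fact assms(1) assms(2))+
  have e: "0 < pd_theta e (thermo U)" if "U \<in> state_domain" for U :: "real^('n + 3 + 1)"
    using assms(4) thermo_in_domain[OF that] by blast
  have pd: "positive_definite (\<chi> i j. pd_rho j (pd_rho i (free_energy \<psi>)) (thermo U))"
    if "U \<in> state_domain" for U :: "real^('n + 3 + 1)"
    using assms(5) thermo_in_domain[OF that] by blast
  have 1: ?conserved
  proof (intro conjI ballI)
    show "bij_betw (A_map e) state_domain (A_map e ` state_domain)"
      by (rule inj_on_imp_bij_betw[OF conserved_inj[OF bspec[OF assms(4)]]])
    show "invertible (jacobian (A_map e) (at U))" if "U \<in> state_domain" for U
      by (rule conserved_jacobian_invertible[OF that e[OF that]])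
  qed (rule Ck_conserved)
  have 2: ?compatible
  proof (intro ballI conjI allI)
    fix U :: "real^('n + 3 + 1)" assume U: "U \<in> state_domain"
    show "gradient (H_fun \<eta>) U = G_map \<mu> U v* jacobian (A_map e) (at U)"
      unfolding vec_eq_iff gradient_eqI[OF entropy_has_derivative[OF U]]
        vector_matrix_jacobian_nth[OF conserved_has_derivative[OF U]] entropy_compatible[OF U] by blast
    show "gradient (Q_fun \<eta> \<alpha>) U = G_map \<mu> U v* jacobian (F_map e p \<alpha>) (at U)" for \<alpha>
      unfolding vec_eq_iff gradient_eqI[OF entropy_flux_has_derivative[OF U]]
        vector_matrix_jacobian_nth[OF flux_has_derivative[OF U]] entropy_flux_compatible[OF U] by blast
  qed
  have 3: ?convex
  proof
    fix U :: "real^('n + 3 + 1)" assume U: "U \<in> state_domain"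
    let ?M = "hessian (H_fun \<eta>) U - (\<Sum>j\<in>UNIV. G_map \<mu> U $ j *\<^sub>R hessian (\<lambda>V. A_map e V $ j) U)"
    have compat: "(H_fun \<eta> has_derivative (\<lambda>h. G_map \<mu> V \<bullet> d_conserved V h)) (at V)"
      if "V \<in> state_domain" for V
      unfolding entropy_compatible[OF that] by (rule entropy_has_derivative[OF that])
    note G' = entropy_variable_has_derivative[OF U]
    note hess = compatible_entropy_hessian[where A' = d_conserved and G = "G_map \<mu>", OF open_state_domain U
        Ck_entropy_density Ck_conserved conserved_has_derivative G' compat]
    have "symmetric_matrix ?M" by (rule hess(1))
    moreover have "positive_definite ?M"
      unfolding positive_definite_def
    proof (intro allI impI)
      fix h :: "real^('n + 3 + 1)" assume "h \<noteq> 0"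
      show "0 < h \<bullet> (?M *v h)"
        by (subst hess(2)) (assumption | rule entropy_quadratic_form_pos[OF U e[OF U] pd[OF U] \<open>h \<noteq> 0\<close> G'])+
    qed
    ultimately show "let M = ?M in symmetric_matrix M \<and> positive_definite M"
      unfolding Let_def by (rule conjI)
  qed
  have 4: ?balance
    by (intro allI impI ballI, elim conjE, rule conjI)
      (rule entropy_balance entropy_production_nonneg[OF _ _ assms(9,6,7,8)]; assumption)+
  show ?thesis by (rule conjI[OF 1 conjI[OF 2 conjI[OF 3 4]]])
qed

end
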